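(* Let $\mathbf{k}$ be a field and $\Gamma$ a $(d-1)$-dimensional simplicial complex on $[n]$ with upper skips $1=Q_0<Q_1<\dots<Q_{d-1}$. For $1\le i\le d-1$ set $$c_i=\prod_{1\le u\le d-1,\,u\neq i}Q_u(Q_u-1)\prod_{1\le u<v\le d-1,\ u,v\neq i}(Q_v-Q_u).$$ Then $f_{d-1}(\Gamma)\le\frac{1}{(n-d)!}\prod_{i=1}^{n-d}M_i(S/I_\Gamma)$ if and only if $$\sum_{i=1}^{d-1}c_i\sum_{j=0}^{i-1}(-1)^{i-j-1}A(j,Q_i)\ge0.$$
   Context: A simplicial complex on $[n]$ is a family of subsets closed under subsets containing all singletons; $f_i$ counts faces of size $i+1$. For $S=\mathbf{k}[x_1,\dots,x_n]$ and Stanley–Reisner ideal $I_\Gamma$, $M_i=\max\{|W|:W\subseteq[n],\ \tilde H_{|W|-i-1}(\Gamma[W];\mathbf{k})\neq0\}$ (maximal shifts of the minimal free resolution of $S/I_\Gamma$). For $1\le i\le n-d$ these are strictly increasing integers in $\{2,\dots,n\}$; the $d$ elements of $[n]$ not among $M_1,\dots,M_{n-d}$ are the upper skips $Q_0=1<Q_1<\dots<Q_{d-1}$. For $0\le p<d$ and $1\le m\le n$, $A(p,m)=\binom{n}{m}^{-1}\sum_{W\subseteq[n],|W|=m}\tilde\beta_p(\Gamma[W];\mathbf{k})$, where $\tilde\beta_p=\dim_{\mathbf{k}}\tilde H_p$ and $\Gamma[W]$ is the induced subcomplex. *)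

theory Defs
  imports Complex_Main "HOL-Library.Function_Algebras"
begin

definition simplicial_complex :: "nat \<Rightarrow> nat set set \<Rightarrow> bool" where
  "simplicial_complex n \<Gamma> \<longleftrightarrow>
     \<Gamma> \<subseteq> Pow {1..n} \<and> {} \<in> \<Gamma> \<and>
     (\<forall>\<sigma>\<in>\<Gamma>. \<forall>\<tau>. \<tau> \<subseteq> \<sigma> \<longrightarrow> \<tau> \<in> \<Gamma>) \<and>
     (\<forall>i\<in>{1..n}. {i} \<in> \<Gamma>)"

definition fvec :: "nat set set \<Rightarrow> nat \<Rightarrow> nat" where
  "fvec \<Gamma> i = card {\<sigma>\<in>\<Gamma>. card \<sigma> = i + 1}"

definition induced :: "nat set set \<Rightarrow> nat set \<Rightarrow> nat set set" where
  "induced \<Gamma> W = {\<sigma>\<in>\<Gamma>. \<sigma> \<subseteq> W}"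

text \<open>Chain space C_q (augmented: the empty face is the unique (-1)-face):
  k-valued functions supported on faces of size q+1.\<close>
definition chains :: "'k::field itself \<Rightarrow> nat set set \<Rightarrow> int \<Rightarrow> (nat set \<Rightarrow> 'k) set" where
  "chains K \<Delta> q = {c. \<forall>\<sigma>. c \<sigma> \<noteq> 0 \<longrightarrow> \<sigma> \<in> \<Delta> \<and> int (card \<sigma>) = q + 1}"

text \<open>Simplicial boundary map with vertices oriented by their natural order:
  the face (v_0 < ... < v_q) is sent to sum_j (-1)^j (v_0..v_j-hat..v_q).
  On 0-chains this is the augmentation map to C_{-1}.\<close>
definition bd :: "nat set set \<Rightarrow> (nat set \<Rightarrow> 'k::field) \<Rightarrow> (nat set \<Rightarrow> 'k)" where
  "bd \<Delta> c = (\<lambda>\<sigma>. \<Sum>v\<in>(\<Union>\<Delta>) - \<sigma>. (-1) ^ card {u\<in>\<sigma>. u < v} * c (insert v \<sigma>))"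

definition rbetti :: "'k::field itself \<Rightarrow> nat set set \<Rightarrow> int \<Rightarrow> nat" where
  "rbetti K \<Delta> q =
     vector_space.dim (\<lambda>(a::'k) (f::nat set \<Rightarrow> 'k) x. a * f x) {c \<in> chains K \<Delta> q. bd \<Delta> c = (\<lambda>_. 0)}
     - vector_space.dim (\<lambda>(a::'k) (f::nat set \<Rightarrow> 'k) x. a * f x) (bd \<Delta> ` chains K \<Delta> (q + 1))"

definition Mshift :: "'k::field itself \<Rightarrow> nat \<Rightarrow> nat set set \<Rightarrow> nat \<Rightarrow> nat" where
  "Mshift K n \<Gamma> i = Max {card W | W. W \<subseteq> {1..n} \<and>
       rbetti K (induced \<Gamma> W) (int (card W) - int i - 1) \<noteq> 0}"

definition upper_skip :: "'k::field itself \<Rightarrow> nat \<Rightarrow> nat \<Rightarrow> nat set set \<Rightarrow> nat \<Rightarrow> nat" where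
  "upper_skip K n d \<Gamma> k =
     sorted_list_of_set ({1..n} - Mshift K n \<Gamma> ` {1..n - d}) ! k"

definition Aavg :: "'k::field itself \<Rightarrow> nat \<Rightarrow> nat set set \<Rightarrow> nat \<Rightarrow> nat \<Rightarrow> real" where
  "Aavg K n \<Gamma> p m = (\<Sum>W\<in>{W. W \<subseteq> {1..n} \<and> card W = m}. real (rbetti K (induced \<Gamma> W) (int p)))
                       / real (n choose m)"

definition ccoef :: "(nat \<Rightarrow> nat) \<Rightarrow> nat \<Rightarrow> nat \<Rightarrow> real" where
  "ccoef Q d i =
     (\<Prod>u\<in>{1..d-1} - {i}. real (Q u) * (real (Q u) - 1)) *
     (\<Prod>(u,v)\<in>{(u,v). u \<in> {1..d-1} - {i} \<and> v \<in> {1..d-1} - {i} \<and> u < v}. real (Q v) - real (Q u))"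

end

theory Submission
  imports Defs "HOL-Computational_Algebra.Polynomial" "HOL-Library.Indicator_Function"
begin

text \<open>
  Average the Euler characteristic of \<open>\<Gamma>[W]\<close> over all \<open>W\<close> of size \<open>m\<close>. A face of size \<open>s\<close> lies in
  the fraction \<open>(m choose s) / (n choose s)\<close> of these sets, so the average is a polynomial in \<open>m\<close> of
  degree at most \<open>d\<close> whose \<open>d\<close>-th coefficient is a multiple of \<open>f\<^sub>d\<^sub>-\<^sub>1\<close>. Lagrange interpolation at the
  nodes \<open>0, Q\<^sub>0 = 1, Q\<^sub>1, \<dots>, Q\<^sub>d\<^sub>-\<^sub>1\<close> expresses that coefficient by the values at the skips. There the
  average is an alternating sum of averaged Betti numbers by Euler--Poincare, and those in degrees
  \<open>\<ge> i\<close> vanish at \<open>Q\<^sub>i\<close>. Together with \<open>\<Prod>M\<^sub>i \<cdot> \<Prod>Q\<^sub>u = n!\<close> this is the criterion.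

  The vanishing rests on \<open>M\<^sub>0 < M\<^sub>1 < \<dots> < M\<^sub>n\<^sub>-\<^sub>d\<close>. If a non-zero class on \<open>\<Gamma>[W]\<close> contributing to \<open>M\<^sub>i\<close>
  could not be continued to a larger set contributing to \<open>M\<^sub>i\<^sub>+\<^sub>1\<close>, then the long exact sequences of
  the vertices outside \<open>W\<close> would push it into their common link, and \<open>\<Gamma>\<close> would have a face with
  \<open>n - i > d\<close> vertices.
\<close>

section \<open>Homology of links and deletions\<close>

definition vertex_sign :: "nat \<Rightarrow> nat set \<Rightarrow> 'k::comm_ring_1" where
  "vertex_sign v \<sigma> = (-1) ^ card {u\<in>\<sigma>. u < v}"

definition contract :: "nat \<Rightarrow> (nat set \<Rightarrow> 'k::comm_ring_1) \<Rightarrow> nat set \<Rightarrow> 'k" where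
  "contract v c = (\<lambda>\<sigma>. if v \<in> \<sigma> then 0 else vertex_sign v \<sigma> * c (insert v \<sigma>))"

definition cone :: "nat \<Rightarrow> (nat set \<Rightarrow> 'k::comm_ring_1) \<Rightarrow> nat set \<Rightarrow> 'k" where
  "cone v c = (\<lambda>\<sigma>. if v \<in> \<sigma> then vertex_sign v \<sigma> * c (\<sigma> - {v}) else 0)"

definition boundary :: "nat set \<Rightarrow> (nat set \<Rightarrow> 'k::comm_ring_1) \<Rightarrow> nat set \<Rightarrow> 'k" where
  "boundary X c = (\<Sum>v\<in>X. contract v c)"

lemma sum_fun_apply: "(\<Sum>x\<in>A. f x) y = (\<Sum>x\<in>A. f x y)"
  by (induction A rule: infinite_finite_induct) auto

lemma vertex_sign_insert:
  assumes "v \<notin> \<sigma>"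
  shows "vertex_sign w (insert v \<sigma>) = (if v < w then - vertex_sign w \<sigma> else vertex_sign w \<sigma>)"
proof -
  have "finite {u\<in>\<sigma>. u < w}"
    by (rule finite_subset[of _ "{..<w}"]) auto
  moreover have "{u \<in> insert v \<sigma>. u < w} = (if v < w then insert v {u\<in>\<sigma>. u < w} else {u\<in>\<sigma>. u < w})"
    by auto
  ultimately show ?thesis
    using assms by (simp add: vertex_sign_def)
qed

lemma vertex_sign_remove: "vertex_sign v (\<sigma> - {v}) = vertex_sign v \<sigma>"
  unfolding vertex_sign_def by (rule arg_cong[where f = "\<lambda>A. (-1) ^ card A"]) auto

lemma vertex_sign_mult_self: "vertex_sign v \<sigma> * vertex_sign v \<sigma> = 1"
  by (simp add: vertex_sign_def flip: power_add)

interpretation contract: additive "contract v" for v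
  by unfold_locales (simp add: contract_def fun_eq_iff algebra_simps)

interpretation boundary: additive "boundary X" for X
  by unfold_locales (simp add: boundary_def contract.add sum.distrib)

lemma cone_zero: "cone v 0 = 0"
  by (simp add: cone_def fun_eq_iff)

lemma contract_contract: "contract v (contract v c) = 0"
  by (simp add: contract_def fun_eq_iff)

lemma contract_anticommute: "contract v (contract w c) = - contract w (contract v c)"
proof
  fix \<sigma>
  consider "v \<in> \<sigma> \<or> w \<in> \<sigma> \<or> v = w" | "v \<notin> \<sigma>" "w \<notin> \<sigma>" "v < w" | "v \<notin> \<sigma>" "w \<notin> \<sigma>" "w < v"
    by linarith
  then show "contract v (contract w c) \<sigma> = (- contract w (contract v c)) \<sigma>"
    by cases (auto simp: contract_def vertex_sign_insert insert_commute)
qed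

lemma contract_boundary: "contract v (boundary X c) = - boundary X (contract v c)"
proof -
  have "contract v (boundary X c) = (\<Sum>w\<in>X. contract v (contract w c))"
    unfolding boundary_def by (rule contract.sum)
  also have "\<dots> = - boundary X (contract v c)"
    by (subst contract_anticommute) (simp add: boundary_def sum_negf)
  finally show ?thesis .
qed

lemma boundary_boundary:
  assumes "finite X"
  shows "boundary X (boundary X c) = 0"
  using assms
proof (induction X rule: finite_induct)
  case empty
  show ?case by (simp add: boundary_def)
next
  case (insert v X)
  have "boundary (insert v X) b = contract v b + boundary X b" for b :: "nat set \<Rightarrow> 'a"
    using insert.hyps by (simp add: boundary_def)
  then have "boundary (insert v X) (boundary (insert v X) c) =
      contract v (contract v c + boundary X c) + boundary X (contract v c + boundary X c)"
    by simp
  also have "\<dots> = 0"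
    unfolding contract.add boundary.add contract_contract contract_boundary insert.IH by simp
  finally show ?case .
qed

lemma contract_cone:
  assumes "\<And>\<sigma>. v \<in> \<sigma> \<Longrightarrow> c \<sigma> = 0"
  shows "contract v (cone v c) = c"
proof
  fix \<sigma>
  show "contract v (cone v c) \<sigma> = c \<sigma>"
    using assms by (auto simp: contract_def cone_def vertex_sign_insert vertex_sign_mult_self
        simp flip: mult.assoc)
qed

lemma boundary_cone:
  assumes X: "finite X" "v \<in> X" and c: "\<And>\<sigma>. v \<in> \<sigma> \<Longrightarrow> c \<sigma> = 0"
  shows "boundary X (cone v c) = c - cone v (boundary X c)"
proof
  fix \<sigma>
  show "boundary X (cone v c) \<sigma> = (c - cone v (boundary X c)) \<sigma>"
  proof (cases "v \<in> \<sigma>")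
    case True
    have "boundary X (cone v c) \<sigma> = vertex_sign v \<sigma> * contract v (boundary X (cone v c)) (\<sigma> - {v})"
      using True
      by (simp add: contract_def insert_absorb vertex_sign_remove vertex_sign_mult_self
          flip: mult.assoc)
    also have "\<dots> = - cone v (boundary X c) \<sigma>"
      using True by (simp add: contract_boundary contract_cone c) (simp add: cone_def)
    finally show ?thesis
      using True by (simp add: c)
  next
    case False
    have "boundary X (cone v c) \<sigma> = contract v (cone v c) \<sigma> + (\<Sum>w\<in>X-{v}. contract w (cone v c) \<sigma>)"
      using X by (simp add: boundary_def sum_fun_apply sum.remove)
    also have "(\<Sum>w\<in>X-{v}. contract w (cone v c) \<sigma>) = 0"
      using False by (intro sum.neutral) (simp add: contract_def cone_def)
    finally show ?thesis
      using False by (simp add: contract_cone c) (simp add: cone_def)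
  qed
qed

text \<open>Chains are graded by the size \<open>s\<close> of faces, so \<open>s\<close> stands for dimension \<open>s - 1\<close>. The boundary
  is taken over a fixed vertex set \<open>X\<close>, so that subcomplexes and links share one boundary map.\<close>
definition size_chains :: "nat set set \<Rightarrow> nat \<Rightarrow> (nat set \<Rightarrow> 'k::comm_ring_1) set" where
  "size_chains \<Delta> s = {c. \<forall>\<sigma>. c \<sigma> \<noteq> 0 \<longrightarrow> \<sigma> \<in> \<Delta> \<and> card \<sigma> = s}"

definition cycles :: "nat set \<Rightarrow> nat set set \<Rightarrow> nat \<Rightarrow> (nat set \<Rightarrow> 'k::comm_ring_1) set" where
  "cycles X \<Delta> s = {c \<in> size_chains \<Delta> s. boundary X c = 0}"

definition boundaries :: "nat set \<Rightarrow> nat set set \<Rightarrow> nat \<Rightarrow> (nat set \<Rightarrow> 'k::comm_ring_1) set" where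
  "boundaries X \<Delta> s = boundary X ` size_chains \<Delta> (Suc s)"

definition exact_at :: "'k::comm_ring_1 itself \<Rightarrow> nat set \<Rightarrow> nat set set \<Rightarrow> nat \<Rightarrow> bool" where
  "exact_at K X \<Delta> s \<longleftrightarrow> (cycles X \<Delta> s :: (nat set \<Rightarrow> 'k) set) \<subseteq> boundaries X \<Delta> s"

definition link :: "nat \<Rightarrow> nat set set \<Rightarrow> nat set set" where
  "link v \<Delta> = {\<sigma>. v \<notin> \<sigma> \<and> insert v \<sigma> \<in> \<Delta>}"

definition deletion :: "nat \<Rightarrow> nat set set \<Rightarrow> nat set set" where
  "deletion v \<Delta> = {\<sigma>\<in>\<Delta>. v \<notin> \<sigma>}"

lemma size_chainsI:
  "(\<And>\<sigma>. c \<sigma> \<noteq> 0 \<Longrightarrow> \<sigma> \<in> \<Delta> \<and> card \<sigma> = s) \<Longrightarrow> c \<in> size_chains \<Delta> s"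
  by (simp add: size_chains_def)

lemma size_chainsD:
  "c \<in> size_chains \<Delta> s \<Longrightarrow> c \<sigma> \<noteq> 0 \<Longrightarrow> \<sigma> \<in> \<Delta> \<and> card \<sigma> = s"
  by (simp add: size_chains_def)

lemma size_chains_mono: "\<Delta> \<subseteq> \<Delta>' \<Longrightarrow> size_chains \<Delta> s \<subseteq> size_chains \<Delta>' s"
  by (auto simp: size_chains_def)

lemma zero_size_chains: "0 \<in> size_chains \<Delta> s"
  by (simp add: size_chains_def)

lemma size_chains_add:
  "a \<in> size_chains \<Delta> s \<Longrightarrow> b \<in> size_chains \<Delta> s \<Longrightarrow> a + b \<in> size_chains \<Delta> s"
  by (rule size_chainsI) (metis add.right_neutral plus_fun_apply size_chainsD)

lemma size_chains_uminus: "a \<in> size_chains \<Delta> s \<Longrightarrow> - a \<in> size_chains \<Delta> s"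
  by (simp add: size_chains_def)

lemma size_chains_diff:
  "a \<in> size_chains \<Delta> s \<Longrightarrow> b \<in> size_chains \<Delta> s \<Longrightarrow> a - b \<in> size_chains \<Delta> s"
  using size_chains_add[of a \<Delta> s "- b"] by (simp add: size_chains_uminus)

lemma deletion_chain_eq_0: "c \<in> size_chains (deletion v \<Delta>) s \<Longrightarrow> v \<in> \<sigma> \<Longrightarrow> c \<sigma> = 0"
  by (auto simp: size_chains_def deletion_def)

lemma contract_deletion_chain: "c \<in> size_chains (deletion v \<Delta>) s \<Longrightarrow> contract v c = 0"
  using deletion_chain_eq_0 by (fastforce simp: contract_def)

lemma deletion_chains_subset: "size_chains (deletion v \<Delta>) s \<subseteq> size_chains \<Delta> s"
  by (rule size_chains_mono) (auto simp: deletion_def)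

locale finite_complex =
  fixes X :: "nat set" and \<Delta> :: "nat set set"
  assumes finite_vertices: "finite X"
    and face_subset_vertices: "\<sigma> \<in> \<Delta> \<Longrightarrow> \<sigma> \<subseteq> X"
    and subset_face: "\<sigma> \<in> \<Delta> \<Longrightarrow> \<tau> \<subseteq> \<sigma> \<Longrightarrow> \<tau> \<in> \<Delta>"
begin

lemma finite_face: "\<sigma> \<in> \<Delta> \<Longrightarrow> finite \<sigma>"
  using face_subset_vertices finite_vertices finite_subset by blast

lemma finite_faces: "finite \<Delta>"
  by (rule finite_subset[of _ "Pow X"]) (use finite_vertices face_subset_vertices in auto)

lemma finite_complex_induced: "finite_complex X (induced \<Delta> W)"
  by unfold_locales
    (use finite_vertices face_subset_vertices subset_face in \<open>auto simp: induced_def\<close>)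

lemma finite_complex_link: "finite_complex X (link v \<Delta>)"
proof
  show "\<tau> \<in> link v \<Delta>" if "\<sigma> \<in> link v \<Delta>" "\<tau> \<subseteq> \<sigma>" for \<sigma> \<tau>
    using that subset_face[of "insert v \<sigma>" "insert v \<tau>"] by (auto simp: link_def)
qed (use finite_vertices face_subset_vertices in \<open>auto simp: link_def\<close>)

lemma link_subset_deletion: "link v \<Delta> \<subseteq> deletion v \<Delta>"
  using subset_face by (fastforce simp: link_def deletion_def)

lemma boundary_chain:
  assumes "c \<in> size_chains \<Delta> (Suc s)"
  shows "boundary X c \<in> size_chains \<Delta> s"
proof (rule size_chainsI)
  fix \<sigma> assume "boundary X c \<sigma> \<noteq> 0"
  then obtain v where "contract v c \<sigma> \<noteq> 0"
    unfolding boundary_def sum_fun_apply by (meson sum.not_neutral_contains_not_neutral)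
  then have "v \<notin> \<sigma>" "c (insert v \<sigma>) \<noteq> 0"
    by (auto simp: contract_def split: if_splits)
  moreover from this have "insert v \<sigma> \<in> \<Delta>" "card (insert v \<sigma>) = Suc s"
    using size_chainsD[OF assms] by auto
  ultimately show "\<sigma> \<in> \<Delta> \<and> card \<sigma> = s"
    using finite_face[of "insert v \<sigma>"] subset_face[of "insert v \<sigma>" \<sigma>] by auto
qed

lemma boundaries_subset_cycles: "boundaries X \<Delta> s \<subseteq> cycles X \<Delta> s"
  using boundary_chain boundary_boundary[OF finite_vertices]
  by (auto simp: cycles_def boundaries_def)

lemma contract_chain:
  assumes "c \<in> size_chains \<Delta> (Suc s)"
  shows "contract v c \<in> size_chains (link v \<Delta>) s"
proof (rule size_chainsI)
  fix \<sigma> assume "contract v c \<sigma> \<noteq> 0"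
  then have "v \<notin> \<sigma>" "c (insert v \<sigma>) \<noteq> 0"
    by (auto simp: contract_def split: if_splits)
  with size_chainsD[OF assms, of "insert v \<sigma>"] finite_face[of "insert v \<sigma>"]
  show "\<sigma> \<in> link v \<Delta> \<and> card \<sigma> = s"
    by (auto simp: link_def)
qed

lemma cone_chain:
  assumes "c \<in> size_chains (link v \<Delta>) s"
  shows "cone v c \<in> size_chains \<Delta> (Suc s)"
proof (rule size_chainsI)
  fix \<sigma> assume "cone v c \<sigma> \<noteq> 0"
  then have "v \<in> \<sigma>" "c (\<sigma> - {v}) \<noteq> 0"
    by (auto simp: cone_def split: if_splits)
  moreover from this have "\<sigma> \<in> \<Delta>" "card (\<sigma> - {v}) = s"
    using size_chainsD[OF assms, of "\<sigma> - {v}"] by (auto simp: link_def insert_absorb)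
  ultimately show "\<sigma> \<in> \<Delta> \<and> card \<sigma> = Suc s"
    using finite_face by (metis card_Suc_Diff1)
qed

lemma diff_cone_contract_chain:
  assumes c: "c \<in> size_chains \<Delta> s"
  shows "c - cone v (contract v c) \<in> size_chains (deletion v \<Delta>) s"
proof (rule size_chainsI)
  fix \<sigma> assume nz: "(c - cone v (contract v c)) \<sigma> \<noteq> 0"
  have "cone v (contract v c) \<sigma> = c \<sigma>" if "v \<in> \<sigma>"
    using that
    by (simp add: cone_def contract_def insert_absorb vertex_sign_remove vertex_sign_mult_self
        flip: mult.assoc)
  with nz have "v \<notin> \<sigma>" by auto
  moreover from this nz have "c \<sigma> \<noteq> 0" by (simp add: cone_def)
  ultimately show "\<sigma> \<in> deletion v \<Delta> \<and> card \<sigma> = s"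
    using size_chainsD[OF c] by (simp add: deletion_def)
qed

text \<open>Two pieces of the long exact sequence
  \<open>\<dots> \<rightarrow> H(\<Delta>) \<rightarrow> H(link v \<Delta>) \<rightarrow> H(deletion v \<Delta>) \<rightarrow> H(\<Delta>) \<rightarrow> \<dots>\<close> of a vertex.\<close>

lemma exact_at_deletion:
  fixes K :: "'k::comm_ring_1 itself"
  assumes v: "v \<in> X" and ex: "exact_at K X \<Delta> s" and ex_link: "exact_at K X (link v \<Delta>) s"
  shows "exact_at K X (deletion v \<Delta>) s"
  unfolding exact_at_def
proof
  fix c :: "nat set \<Rightarrow> 'k" assume "c \<in> cycles X (deletion v \<Delta>) s"
  then have c: "c \<in> size_chains (deletion v \<Delta>) s" "boundary X c = 0"
    by (auto simp: cycles_def)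
  then have "c \<in> cycles X \<Delta> s"
    using deletion_chains_subset by (auto simp: cycles_def)
  with ex obtain y where y: "y \<in> size_chains \<Delta> (Suc s)" "boundary X y = c"
    by (auto simp: exact_at_def boundaries_def)
  define p where "p = contract v y"
  have p: "p \<in> size_chains (link v \<Delta>) s" "boundary X p = 0"
    using contract_chain[OF y(1)] contract_boundary[of v X y] contract_deletion_chain[OF c(1)]
    by (auto simp: p_def y(2))
  with ex_link obtain z where z: "z \<in> size_chains (link v \<Delta>) (Suc s)" "boundary X z = p"
    by (auto simp: exact_at_def boundaries_def cycles_def)
  have "boundary X (cone v p) = p"
    using boundary_cone[OF finite_vertices v, of p] p(2)
    by (simp add: cone_zero) (simp add: p_def contract_def)
  then have "boundary X (z + (y - cone v p)) = c"
    by (simp add: boundary.add boundary.diff y z)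
  moreover have "z + (y - cone v p) \<in> size_chains (deletion v \<Delta>) (Suc s)"
    unfolding p_def
    by (intro size_chains_add diff_cone_contract_chain y(1)
        subsetD[OF size_chains_mono[OF link_subset_deletion] z(1)])
  ultimately show "c \<in> boundaries X (deletion v \<Delta>) s"
    by (auto simp: boundaries_def)
qed

lemma exact_at_link:
  fixes K :: "'k::comm_ring_1 itself"
  assumes v: "v \<in> X" and ex_del: "exact_at K X (deletion v \<Delta>) s" and ex: "exact_at K X \<Delta> (Suc s)"
  shows "exact_at K X (link v \<Delta>) s"
  unfolding exact_at_def
proof
  fix p :: "nat set \<Rightarrow> 'k" assume "p \<in> cycles X (link v \<Delta>) s"
  then have p: "p \<in> size_chains (link v \<Delta>) s" "boundary X p = 0"
    by (auto simp: cycles_def)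
  then have p_del: "p \<in> size_chains (deletion v \<Delta>) s"
    using size_chains_mono[OF link_subset_deletion] by blast
  with p ex_del obtain y where y: "y \<in> size_chains (deletion v \<Delta>) (Suc s)" "boundary X y = p"
    by (auto simp: exact_at_def boundaries_def cycles_def)
  have "boundary X (cone v p) = p"
    using boundary_cone[OF finite_vertices v deletion_chain_eq_0[OF p_del]] p(2)
    by (simp add: cone_zero)
  then have "cone v p - y \<in> cycles X \<Delta> (Suc s)"
    using size_chains_diff[OF cone_chain[OF p(1)] subsetD[OF deletion_chains_subset y(1)]]
    by (simp add: cycles_def boundary.diff y(2))
  with ex obtain w where w: "w \<in> size_chains \<Delta> (Suc (Suc s))" "boundary X w = cone v p - y"
    by (auto simp: exact_at_def boundaries_def)
  have "boundary X (- contract v w) = contract v (boundary X w)"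
    by (simp add: boundary.minus contract_boundary)
  also have "\<dots> = p"
    using contract_cone[OF deletion_chain_eq_0[OF p_del]] contract_deletion_chain[OF y(1)]
    by (simp add: w(2) contract.diff)
  finally show "p \<in> boundaries X (link v \<Delta>) s"
    using size_chains_uminus[OF contract_chain[OF w(1)]] by (auto simp: boundaries_def)
qed

lemma exact_at_0:
  fixes K :: "'k::comm_ring_1 itself"
  assumes "{w} \<in> \<Delta>"
  shows "exact_at K X \<Delta> 0"
  unfolding exact_at_def
proof
  fix c :: "nat set \<Rightarrow> 'k" assume c: "c \<in> cycles X \<Delta> 0"
  have supp: "\<sigma> = {}" if "c \<sigma> \<noteq> 0" for \<sigma>
    using c that finite_face by (auto simp: cycles_def dest: size_chainsD)
  then have "c \<in> size_chains (link w \<Delta>) 0"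
    using assms by (intro size_chainsI) (fastforce simp: link_def)
  then have "cone w c \<in> size_chains \<Delta> (Suc 0)"
    by (rule cone_chain)
  moreover have "boundary X (cone w c) = c"
    using boundary_cone[OF finite_vertices, of w c] face_subset_vertices[OF assms] supp c
    by (auto simp: cycles_def cone_zero)
  ultimately show "c \<in> boundaries X \<Delta> 0"
    unfolding boundaries_def by (metis imageI)
qed

lemma exact_at_ge_card:
  fixes K :: "'k::comm_ring_1 itself"
  assumes W: "\<And>\<sigma>. \<sigma> \<in> \<Delta> \<Longrightarrow> \<sigma> \<subseteq> W" "W \<subseteq> X" "W \<noteq> {}" "card W \<le> s"
  shows "exact_at K X \<Delta> s"
  unfolding exact_at_def
proof
  fix c :: "nat set \<Rightarrow> 'k" assume c: "c \<in> cycles X \<Delta> s"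
  obtain w where w: "w \<in> W" using W(3) by blast
  have finW: "finite W" using W(2) finite_vertices finite_subset by blast
  have supp: "\<sigma> = W" if "c \<sigma> \<noteq> 0" for \<sigma>
  proof -
    have "\<sigma> \<subseteq> W" "card \<sigma> = s"
      using c that W(1) by (auto simp: cycles_def dest: size_chainsD)
    then show ?thesis using W(4) finW by (metis card_seteq)
  qed
  have "contract v c (W - {w}) = (if v = w then vertex_sign w W * c W else 0)" for v
  proof (cases "v = w")
    case True
    then show ?thesis using w by (simp add: contract_def insert_absorb vertex_sign_remove)
  next
    case False
    then have "w \<notin> insert v (W - {w})" by simp
    then have "insert v (W - {w}) \<noteq> W" using w by metis
    then have "c (insert v (W - {w})) = 0" using supp by blast
    with False show ?thesis by (simp add: contract_def)
  qed
  then have "boundary X c (W - {w}) = vertex_sign w W * c W"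
    using w W(2) finite_vertices by (auto simp: boundary_def sum_fun_apply)
  then have "vertex_sign w W * (vertex_sign w W * c W) = 0"
    using c by (simp add: cycles_def)
  then have "c W = 0"
    by (simp add: vertex_sign_mult_self flip: mult.assoc)
  then have "c = boundary X 0"
    using supp by (auto simp: boundary.zero fun_eq_iff)
  then show "c \<in> boundaries X \<Delta> s"
    using zero_size_chains by (auto simp: boundaries_def)
qed

end

lemma not_exact_at_empty_face: "\<not> exact_at K X {{}} 0"
  for K :: "'k::comm_ring_1 itself"
proof
  assume ex: "exact_at K X {{}} 0"
  have "contract v (indicator {{}} :: nat set \<Rightarrow> 'k) = 0" for v
    by (simp add: contract_def fun_eq_iff)
  then have "(indicator {{}} :: nat set \<Rightarrow> 'k) \<in> cycles X {{}} 0"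
    by (auto simp: cycles_def boundary_def size_chains_def indicator_def)
  with ex obtain y :: "nat set \<Rightarrow> 'k" where y: "y \<in> size_chains {{}} (Suc 0)"
      "boundary X y = indicator {{}}"
    by (auto simp: exact_at_def boundaries_def)
  from y(1) have "y = 0"
    by (fastforce simp: size_chains_def)
  with y(2) have "(indicator {{}} :: nat set \<Rightarrow> 'k) {} = 0"
    by (simp add: boundary.zero)
  then show False by simp
qed

lemma deletion_induced: "v \<notin> W \<Longrightarrow> deletion v (induced \<Delta> (insert v W)) = induced \<Delta> W"
  by (auto simp: deletion_def induced_def)

lemma link_induced: "v \<notin> W \<Longrightarrow> link v (induced \<Delta> (insert v W)) = induced (link v \<Delta>) W"
  by (auto simp: link_def induced_def)

lemma face_of_not_exact_at:
  assumes "\<not> exact_at K X \<Delta> s"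
  shows "\<exists>\<sigma>\<in>\<Delta>. card \<sigma> = s"
proof (rule ccontr)
  assume "\<not> ?thesis"
  then have "c = 0" if "c \<in> size_chains \<Delta> s" for c :: "nat set \<Rightarrow> 'a"
    using size_chainsD[OF that] by (auto simp: fun_eq_iff)
  then have "(cycles X \<Delta> s :: (nat set \<Rightarrow> 'a) set) \<subseteq> {boundary X 0}"
    by (auto simp: cycles_def boundary.zero)
  also have "\<dots> \<subseteq> boundaries X \<Delta> s"
    using zero_size_chains by (auto simp: boundaries_def)
  finally show False
    using assms by (simp add: exact_at_def)
qed

lemma face_of_unextendable_homology:
  assumes "finite V" "finite_complex X \<Delta>" "V \<subseteq> X" "V \<inter> W = {}"
    and "\<not> exact_at K X (induced \<Delta> W) s"
    and "\<And>T. T \<subseteq> V \<Longrightarrow> T \<noteq> {} \<Longrightarrow> exact_at K X (induced \<Delta> (W \<union> T)) (s + card T - 1)"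
  shows "\<exists>\<sigma>\<in>\<Delta>. card \<sigma> = s + card V"
  using assms
proof (induction V arbitrary: \<Delta> rule: finite_induct)
  case empty
  then show ?case
    using face_of_not_exact_at by (fastforce simp: induced_def)
next
  case (insert v V)
  interpret finite_complex X \<Delta> by fact
  have v: "v \<in> X" "v \<notin> W" using insert.prems by auto
  have "\<not> exact_at K X (induced (link v \<Delta>) W) s"
    using finite_complex.exact_at_deletion[OF finite_complex_induced[of "insert v W"] v(1)]
      insert.prems(4) insert.prems(5)[of "{v}"] v(2)
    by (auto simp: deletion_induced link_induced)
  moreover have "exact_at K X (induced (link v \<Delta>) (W \<union> T)) (s + card T - 1)"
    if T: "T \<subseteq> V" "T \<noteq> {}" for T
  proof -
    have "finite T" using T insert.hyps finite_subset by blast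
    then have "card T > 0" "card (insert v T) = Suc (card T)"
      using T insert.hyps by (auto simp: card_gt_0_iff card_insert_if)
    then have "exact_at K X (induced \<Delta> (insert v (W \<union> T))) (Suc (s + card T - 1))"
      using insert.prems(5)[of "insert v T"] T by (auto simp: subset_insertI2)
    moreover have "exact_at K X (induced \<Delta> (W \<union> T)) (s + card T - 1)"
      using insert.prems(5)[of T] T by auto
    moreover have "v \<notin> W \<union> T" using T insert.hyps v by auto
    ultimately show ?thesis
      using finite_complex.exact_at_link[OF finite_complex_induced[of "insert v (W \<union> T)"] v(1)]
      by (simp add: deletion_induced link_induced)
  qed
  ultimately obtain \<sigma> where "insert v \<sigma> \<in> \<Delta>" "v \<notin> \<sigma>" "card \<sigma> = s + card V"
    using insert.IH[OF finite_complex_link, of v] insert.prems by (auto simp: link_def)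
  then show ?case
    using insert.hyps finite_face[of "insert v \<sigma>"] by (intro bexI[of _ "insert v \<sigma>"]) auto
qed

section \<open>Betti numbers and the Euler characteristic\<close>

definition (in vector_space) finitely_spanned :: "'b set \<Rightarrow> bool" where
  "finitely_spanned V \<longleftrightarrow> (\<exists>F. finite F \<and> V \<subseteq> span F)"

lemma (in vector_space) finitely_spanned_subset: "finitely_spanned T \<Longrightarrow> S \<subseteq> T \<Longrightarrow> finitely_spanned S"
  unfolding finitely_spanned_def by blast

lemma (in vector_space) finitely_spanned_basis_extension:
  assumes "finitely_spanned V" "B \<subseteq> V" "independent B"
  obtains C where "B \<subseteq> C" "C \<subseteq> V" "independent C" "V \<subseteq> span C" "finite C" "card C = dim V"
proof -
  obtain C where C: "B \<subseteq> C" "C \<subseteq> V" "independent C" "V \<subseteq> span C"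
    using maximal_independent_subset_extend[OF assms(2,3)] by blast
  moreover have "finite C"
    using assms(1) C(2,3) independent_span_bound unfolding finitely_spanned_def by blast
  moreover have "card C = dim V"
    using basis_card_eq_dim C by blast
  ultimately show thesis using that by blast
qed

lemma (in vector_space) dim_mono_finitely_spanned:
  assumes "finitely_spanned T" "S \<subseteq> T"
  shows "dim S \<le> dim T"
proof -
  obtain B where B: "B \<subseteq> S" "independent B" "card B = dim S"
    using basis_exists[of S] .
  then obtain C where "B \<subseteq> C" "finite C" "card C = dim T"
    using finitely_spanned_basis_extension[of T B] assms by (metis subset_trans)
  with B show ?thesis by (metis card_mono)
qed

lemma (in vector_space) subspace_dim_equal_finitely_spanned:
  assumes "subspace S" "S \<subseteq> T" "finitely_spanned T" "dim T \<le> dim S"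
  shows "S = T"
proof -
  obtain B where B: "B \<subseteq> S" "independent B" "card B = dim S"
    using basis_exists[of S] .
  then obtain C where C: "B \<subseteq> C" "T \<subseteq> span C" "finite C" "card C = dim T"
    using finitely_spanned_basis_extension[of T B] assms by (metis subset_trans)
  then have "B = C"
    using B assms(4) by (metis card_seteq)
  then show ?thesis
    using B C assms(1,2) by (metis span_minimal subset_antisym subset_trans)
qed

lemma (in vector_space) dim_subset_0: "S \<subseteq> {0} \<Longrightarrow> dim S = 0"
  using dim_le_card[of S "{}"] by simp

lemma (in vector_space) span_Int_span_of_independent_Un:
  assumes ind: "independent (B \<union> D)" and disj: "B \<inter> D = {}" and x: "x \<in> span B" "x \<in> span D"
  shows "x = 0"
proof -
  have "representation (B \<union> D) x = representation B x"
    "representation (B \<union> D) x = representation D x"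
    using representation_extend[OF ind] x by blast+
  then have "representation (B \<union> D) x b = 0" for b
    using representation_ne_zero[of B x b] representation_ne_zero[of D x b] disj by auto
  moreover have "x \<in> span (B \<union> D)"
    using x span_mono by blast
  ultimately show ?thesis
    using sum_nonzero_representation_eq[OF ind, of x] by simp
qed

lemma (in Vector_Spaces.linear) dim_image_eq_card:
  assumes D: "vs1.independent D" "D \<subseteq> V" "f ` V \<subseteq> vs2.span (f ` D)" and inj: "inj_on f (vs1.span D)"
  shows "vs2.dim (f ` V) = card D"
proof -
  interpret vector_space_pair s1 s2 by unfold_locales
  have "vs2.independent (f ` D)"
    using independent_inj_on_image[OF D(1) inj] .
  then have "card (f ` D) = vs2.dim (f ` V)"
    using D(2,3) by (intro vs2.basis_card_eq_dim) auto
  moreover have "card (f ` D) = card D"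
    using card_image inj_on_subset[OF inj vs1.span_superset] by blast
  ultimately show ?thesis by simp
qed

lemma (in Vector_Spaces.linear) rank_nullity:
  assumes V: "vs1.subspace V" "vs1.finitely_spanned V"
  shows "vs1.dim V = vs1.dim {x\<in>V. f x = 0} + vs2.dim (f ` V)"
proof -
  let ?ker = "{x\<in>V. f x = 0}"
  obtain B where B: "B \<subseteq> ?ker" "vs1.independent B" "?ker \<subseteq> vs1.span B" "card B = vs1.dim ?ker"
    using vs1.basis_exists[of ?ker] .
  then obtain C where C: "B \<subseteq> C" "C \<subseteq> V" "vs1.independent C" "V \<subseteq> vs1.span C" "finite C"
      "card C = vs1.dim V"
    using vs1.finitely_spanned_basis_extension[OF V(2), of B]
    by (metis (lifting) mem_Collect_eq subset_iff)
  define D where "D = C - B"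
  have spanD: "vs1.span D \<subseteq> V"
    using C(2) V(1) by (intro vs1.span_minimal) (auto simp: D_def)
  have inj: "inj_on f (vs1.span D)"
  proof (rule inj_onI)
    fix x y assume xy: "x \<in> vs1.span D" "y \<in> vs1.span D" "f x = f y"
    then have "x - y \<in> vs1.span D" "f (x - y) = 0"
      by (simp_all add: vs1.span_diff diff)
    then show "x = y"
      using vs1.span_Int_span_of_independent_Un[of B D "x - y"] B(3) C(1,3) spanD
      by (auto simp: D_def Un_absorb1)
  qed
  have "f ` V \<subseteq> vs2.span (f ` D)"
  proof -
    have "f ` V \<subseteq> vs2.span (f ` C)"
      using C(4) span_image[of C] by blast
    also have "f ` C \<subseteq> insert 0 (f ` D)"
      using B(1) by (auto simp: D_def)
    then have "vs2.span (f ` C) \<subseteq> vs2.span (f ` D)"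
      using vs2.span_mono vs2.span_insert_0 by blast
    finally show ?thesis .
  qed
  moreover have "vs1.independent D" "D \<subseteq> V"
    using vs1.independent_mono[OF C(3)] C(2) by (auto simp: D_def)
  ultimately have "vs2.dim (f ` V) = card D"
    by (intro dim_image_eq_card inj)
  moreover have "card C = card B + card D"
    unfolding D_def using C(1,5)
    by (metis card_Diff_subset card_mono finite_subset le_add_diff_inverse)
  ultimately show ?thesis using B(4) C(6) by simp
qed

definition fun_scale :: "'k::field \<Rightarrow> ('a \<Rightarrow> 'k) \<Rightarrow> 'a \<Rightarrow> 'k" where
  "fun_scale = (\<lambda>a f x. a * f x)"

lemma fun_scale_apply [simp]: "fun_scale a f x = a * f x"
  by (simp add: fun_scale_def)

interpretation fun_space: vector_space fun_scale
  by unfold_locales (auto simp: algebra_simps fun_eq_iff)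

lemma supported_subset_span_indicators:
  assumes "finite F"
  shows "{c. \<forall>x. c x \<noteq> 0 \<longrightarrow> x \<in> F} \<subseteq> fun_space.span ((\<lambda>x. indicator {x}) ` F)"
proof (rule subsetI, elim CollectE)
  fix c :: "'a \<Rightarrow> 'b" assume c: "\<forall>x. c x \<noteq> 0 \<longrightarrow> x \<in> F"
  have "c = (\<Sum>x\<in>F. fun_scale (c x) (indicator {x}))"
  proof
    fix y
    have "(\<Sum>x\<in>F. c x * indicator {x} y) = (\<Sum>x\<in>F. if x = y then c x else 0)"
      by (intro sum.cong) auto
    also have "\<dots> = c y"
      using assms c by auto
    finally show "c y = (\<Sum>x\<in>F. fun_scale (c x) (indicator {x})) y"
      by (simp add: sum_fun_apply)
  qed
  also have "\<dots> \<in> fun_space.span ((\<lambda>x. indicator {x}) ` F)"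
    by (intro fun_space.span_sum fun_space.span_scale fun_space.span_base) auto
  finally show "c \<in> fun_space.span ((\<lambda>x. indicator {x}) ` F)" .
qed

lemma inj_indicator_singleton: "inj (\<lambda>x. indicator {x} :: 'a \<Rightarrow> 'k::field)"
  by (rule injI) (metis indicator_simps singletonI singletonD zero_neq_one)

lemma independent_indicators:
  assumes "finite F"
  shows "fun_space.independent ((\<lambda>x. indicator {x} :: 'a \<Rightarrow> 'k::field) ` F)"
proof (rule fun_space.independent_if_scalars_zero)
  let ?e = "\<lambda>x. indicator {x} :: 'a \<Rightarrow> 'k"
  show "finite (?e ` F)" using assms by simp
  fix g :: "('a \<Rightarrow> 'k) \<Rightarrow> 'k" and e assume zero: "(\<Sum>e\<in>?e ` F. fun_scale (g e) e) = 0" and "e \<in> ?e ` F"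
  then obtain y where y: "y \<in> F" "e = ?e y" by blast
  have "0 = (\<Sum>e\<in>?e ` F. fun_scale (g e) e) y"
    by (simp add: zero)
  also have "\<dots> = (\<Sum>x\<in>F. g (?e x) * ?e x y)"
    unfolding sum_fun_apply
    by (subst sum.reindex) (auto intro: inj_on_subset[OF inj_indicator_singleton])
  also have "\<dots> = g e"
    using y assms by (simp add: indicator_def if_distrib sum.delta' cong: if_cong)
  finally show "g e = 0" by simp
qed

lemma dim_supported:
  assumes "finite F"
  shows "fun_space.dim {c :: 'a \<Rightarrow> 'k::field. \<forall>x. c x \<noteq> 0 \<longrightarrow> x \<in> F} = card F"
proof (rule fun_space.dim_unique)
  let ?e = "\<lambda>x. indicator {x} :: 'a \<Rightarrow> 'k"
  show "?e ` F \<subseteq> {c. \<forall>x. c x \<noteq> 0 \<longrightarrow> x \<in> F}"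
    by (auto simp: indicator_def)
  show "card (?e ` F) = card F"
    by (rule card_image) (rule inj_on_subset[OF inj_indicator_singleton subset_UNIV])
qed (fact supported_subset_span_indicators[OF assms] independent_indicators[OF assms])+

lemma size_chains_eq_supported:
  "size_chains \<Delta> s = {c. \<forall>\<sigma>. c \<sigma> \<noteq> 0 \<longrightarrow> \<sigma> \<in> {\<sigma>\<in>\<Delta>. card \<sigma> = s}}"
  by (simp add: size_chains_def)

lemma subspace_size_chains: "fun_space.subspace (size_chains \<Delta> s)"
  by (intro fun_space.subspaceI zero_size_chains size_chains_add) (auto simp: size_chains_def)

lemma linear_boundary: "Vector_Spaces.linear fun_scale fun_scale (boundary X)"
proof unfold_locales
  show "boundary X (fun_scale a c) = fun_scale a (boundary X c)" for a :: 'a and c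
    by (auto simp: boundary_def contract_def fun_eq_iff sum_fun_apply sum_distrib_left
        intro!: sum.cong)
qed (rule boundary.add)

lemma bd_eq_boundary:
  assumes "c \<in> size_chains \<Delta> s" "\<Union>\<Delta> \<subseteq> X" "finite X"
  shows "bd \<Delta> c = boundary X c"
proof
  fix \<sigma>
  have "(\<Sum>v\<in>\<Union>\<Delta> - \<sigma>. vertex_sign v \<sigma> * c (insert v \<sigma>)) = (\<Sum>v\<in>X. contract v c \<sigma>)"
  proof (rule sum.mono_neutral_cong_left)
    show "\<forall>v\<in>X - (\<Union>\<Delta> - \<sigma>). contract v c \<sigma> = 0"
      using size_chainsD[OF assms(1)] by (auto simp: contract_def)
  qed (use assms in \<open>auto simp: contract_def\<close>)
  then show "bd \<Delta> c \<sigma> = boundary X c \<sigma>"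
    by (simp add: bd_def boundary_def vertex_sign_def sum_fun_apply)
qed

lemma rbetti_below_minus_1:
  fixes K :: "'k::field itself"
  assumes "q < -1"
  shows "rbetti K \<Delta> q = 0"
proof -
  have "{c \<in> chains K \<Delta> q. bd \<Delta> c = (\<lambda>_. 0)} \<subseteq> {0}"
    using assms by (auto simp: chains_def fun_eq_iff)
  from fun_space.dim_subset_0[OF this] show ?thesis
    by (simp add: rbetti_def fun_scale_def)
qed

lemma boundary_chain_0:
  assumes "c \<in> size_chains \<Delta> 0" "\<And>\<sigma>. \<sigma> \<in> \<Delta> \<Longrightarrow> finite \<sigma>"
  shows "boundary X c = 0"
proof -
  have "c (insert v \<sigma>) = 0" for v \<sigma>
    using size_chainsD[OF assms(1), of "insert v \<sigma>"] assms(2)[of "insert v \<sigma>"]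
    by (metis card_0_eq insert_not_empty)
  then have "contract v c = 0" for v
    unfolding contract_def zero_fun_def by (intro ext) simp
  then show ?thesis
    by (simp add: boundary_def)
qed

lemma alternating_sum_telescope:
  fixes b :: "nat \<Rightarrow> 'a::comm_ring_1"
  shows "(\<Sum>s\<le>N. (-1) ^ s * (b s + b (Suc s))) = b 0 + (-1) ^ N * b (Suc N)"
  by (induction N) (auto simp: algebra_simps)

text \<open>Minus the reduced Euler characteristic, as a face of dimension \<open>q\<close> has \<open>q + 1\<close> elements.\<close>
definition euler_char :: "nat set set \<Rightarrow> real" where
  "euler_char \<Delta> = (\<Sum>\<sigma>\<in>\<Delta>. (-1) ^ card \<sigma>)"

context finite_complex
begin

lemma finitely_spanned_size_chains: "fun_space.finitely_spanned (size_chains \<Delta> s)"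
  unfolding fun_space.finitely_spanned_def size_chains_eq_supported
  by (rule exI[of _ "(\<lambda>\<sigma>. indicator {\<sigma>}) ` {\<sigma>\<in>\<Delta>. card \<sigma> = s}"])
    (intro conjI finite_imageI supported_subset_span_indicators; simp add: finite_faces)

lemma finitely_spanned_cycles: "fun_space.finitely_spanned (cycles X \<Delta> s)"
  by (rule fun_space.finitely_spanned_subset[OF finitely_spanned_size_chains[of s]])
    (auto simp: cycles_def)

lemma dim_boundaries_le_dim_cycles:
  "fun_space.dim (boundaries X \<Delta> s :: (nat set \<Rightarrow> 'k::field) set)
     \<le> fun_space.dim (cycles X \<Delta> s :: (nat set \<Rightarrow> 'k) set)"
  by (intro fun_space.dim_mono_finitely_spanned finitely_spanned_cycles boundaries_subset_cycles)

lemma rbetti_eq_dim_diff: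
  fixes K :: "'k::field itself"
  shows "rbetti K \<Delta> (int s - 1) = fun_space.dim (cycles X \<Delta> s :: (nat set \<Rightarrow> 'k) set)
           - fun_space.dim (boundaries X \<Delta> s :: (nat set \<Rightarrow> 'k) set)"
proof -
  have bd: "bd \<Delta> c = boundary X c" if "c \<in> size_chains \<Delta> t" for t and c :: "nat set \<Rightarrow> 'k"
    using bd_eq_boundary[OF that] face_subset_vertices finite_vertices by blast
  have "chains K \<Delta> (int s - 1) = size_chains \<Delta> s"
    "chains K \<Delta> (int s - 1 + 1) = size_chains \<Delta> (Suc s)"
    by (auto simp: chains_def size_chains_def)
  moreover have "{c \<in> size_chains \<Delta> s. bd \<Delta> c = (\<lambda>_. 0)} = (cycles X \<Delta> s :: (nat set \<Rightarrow> 'k) set)"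
    using bd by (auto simp: cycles_def zero_fun_def)
  moreover have "bd \<Delta> ` size_chains \<Delta> (Suc s) = (boundaries X \<Delta> s :: (nat set \<Rightarrow> 'k) set)"
    unfolding boundaries_def using bd by (rule image_cong[OF refl])
  ultimately show ?thesis
    by (simp add: rbetti_def fun_scale_def)
qed

lemma rbetti_eq_0_iff_exact_at: "rbetti K \<Delta> (int s - 1) = 0 \<longleftrightarrow> exact_at K X \<Delta> s"
  for K :: "'k::field itself"
proof -
  let ?Z = "cycles X \<Delta> s :: (nat set \<Rightarrow> 'k) set" and ?B = "boundaries X \<Delta> s :: (nat set \<Rightarrow> 'k) set"
  interpret Vector_Spaces.linear fun_scale fun_scale "boundary X :: _ \<Rightarrow> _ \<Rightarrow> 'k"
    by (rule linear_boundary)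
  have "fun_space.subspace ?B"
    unfolding boundaries_def by (rule subspace_image[OF subspace_size_chains])
  then have "fun_space.dim ?Z \<le> fun_space.dim ?B \<longleftrightarrow> ?B = ?Z"
    using fun_space.subspace_dim_equal_finitely_spanned[OF _ boundaries_subset_cycles]
      finitely_spanned_cycles by auto
  then show ?thesis
    using boundaries_subset_cycles by (auto simp: rbetti_eq_dim_diff exact_at_def)
qed

lemma card_faces_eq_dim:
  "card {\<sigma>\<in>\<Delta>. card \<sigma> = s} = fun_space.dim (cycles X \<Delta> s :: (nat set \<Rightarrow> 'k::field) set)
     + fun_space.dim (boundary X ` size_chains \<Delta> s :: (nat set \<Rightarrow> 'k) set)"
proof -
  interpret Vector_Spaces.linear fun_scale fun_scale "boundary X :: _ \<Rightarrow> _ \<Rightarrow> 'k"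
    by (rule linear_boundary)
  have "card {\<sigma>\<in>\<Delta>. card \<sigma> = s} = fun_space.dim (size_chains \<Delta> s :: (nat set \<Rightarrow> 'k) set)"
    unfolding size_chains_eq_supported by (rule dim_supported[symmetric]) (simp add: finite_faces)
  then show ?thesis
    using rank_nullity[OF subspace_size_chains finitely_spanned_size_chains]
    by (simp add: cycles_def)
qed

theorem euler_poincare:
  fixes K :: "'k::field itself"
  assumes N: "\<And>\<sigma>. \<sigma> \<in> \<Delta> \<Longrightarrow> card \<sigma> \<le> N"
  shows "euler_char \<Delta> = (\<Sum>s\<le>N. (-1) ^ s * real (rbetti K \<Delta> (int s - 1)))"
proof -
  define z where "z s = real (fun_space.dim (cycles X \<Delta> s :: (nat set \<Rightarrow> 'k) set))" for s
  define b where
    "b s = real (fun_space.dim (boundary X ` size_chains \<Delta> s :: (nat set \<Rightarrow> 'k) set))" for s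
  have betti: "real (rbetti K \<Delta> (int s - 1)) = z s - b (Suc s)" for s
    unfolding rbetti_eq_dim_diff z_def b_def
    using dim_boundaries_le_dim_cycles[of s, where 'k = 'k]
    by (simp add: boundaries_def of_nat_diff)
  have faces: "real (card {\<sigma>\<in>\<Delta>. card \<sigma> = s}) = z s + b s" for s
    by (simp add: card_faces_eq_dim[where 'k = 'k] z_def b_def)
  have "b 0 = 0"
  proof -
    have "boundary X ` (size_chains \<Delta> 0 :: (nat set \<Rightarrow> 'k) set) \<subseteq> {0}"
      using boundary_chain_0 finite_face by blast
    from fun_space.dim_subset_0[OF this] show ?thesis by (simp add: b_def)
  qed
  moreover have "b (Suc N) = 0"
  proof -
    have "c = 0" if "c \<in> size_chains \<Delta> (Suc N)" for c :: "nat set \<Rightarrow> 'k"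
      using size_chainsD[OF that] N by (fastforce simp: fun_eq_iff)
    then have "boundary X ` (size_chains \<Delta> (Suc N) :: (nat set \<Rightarrow> 'k) set) \<subseteq> {0}"
      using boundary.zero by blast
    from fun_space.dim_subset_0[OF this] show ?thesis by (simp add: b_def)
  qed
  ultimately have telescope: "(\<Sum>s\<le>N. (-1) ^ s * (b s + b (Suc s))) = 0"
    by (simp add: alternating_sum_telescope)
  have "euler_char \<Delta> = (\<Sum>s\<le>N. \<Sum>\<sigma>\<in>{\<sigma>\<in>\<Delta>. card \<sigma> = s}. (-1) ^ card \<sigma>)"
    unfolding euler_char_def using N finite_faces by (intro sum.group[symmetric]) auto
  also have "\<dots> = (\<Sum>s\<le>N. (-1) ^ s * (z s + b s))"
    by (simp add: faces mult.commute)
  also have "\<dots> = (\<Sum>s\<le>N. (-1) ^ s * (z s - b (Suc s))) + (\<Sum>s\<le>N. (-1) ^ s * (b s + b (Suc s)))"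
    by (simp add: sum.distrib[symmetric] algebra_simps)
  finally show ?thesis
    by (simp add: telescope betti)
qed

end

section \<open>Interpolation at the skips\<close>

lemma coeff_eq_lagrange:
  fixes p :: "'a::field poly"
  assumes X: "finite X" "card X = Suc d" and deg: "degree p \<le> d"
  shows "coeff p d = (\<Sum>x\<in>X. poly p x / (\<Prod>y\<in>X-{x}. x - y))"
proof -
  define N where "N x = (\<Prod>y\<in>X-{x}. [:-y, 1:])" for x
  define q where "q = (\<Sum>x\<in>X. smult (poly p x / (\<Prod>y\<in>X-{x}. x - y)) (N x))"
  have degree_N: "degree (N x) = d" and coeff_N: "coeff (N x) d = 1" if "x \<in> X" for x
  proof -
    have "degree (N x) = (\<Sum>y\<in>X-{x}. degree [:-y, 1:])"
      unfolding N_def by (rule degree_prod_eq_sum_degree) auto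
    also have "\<dots> = d" using X that by simp
    finally show "degree (N x) = d" .
    moreover have "lead_coeff (N x) = 1" unfolding N_def by (simp add: lead_coeff_prod)
    ultimately show "coeff (N x) d = 1" by simp
  qed
  have poly_N: "poly (N x) z = (if z = x then (\<Prod>y\<in>X-{x}. x - y) else 0)" if "x \<in> X" "z \<in> X" for x z
    using X that by (auto simp: N_def poly_prod intro: prod_zero)
  have "poly q z = poly p z" if "z \<in> X" for z
  proof -
    have "poly q z = (\<Sum>x\<in>X. if z = x then poly p x else 0)"
      unfolding q_def poly_sum using that X by (intro sum.cong) (auto simp: poly_N)
    then show ?thesis using that X by simp
  qed
  moreover have "degree q \<le> d"
    unfolding q_def using degree_N
    by (intro degree_sum_le X) (auto intro: order_trans[OF degree_smult_le])
  ultimately have "p = q"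
    using deg X by (intro poly_eqI_degree[of X]) auto
  then have "coeff p d = coeff q d" by simp
  also have "\<dots> = (\<Sum>x\<in>X. poly p x / (\<Prod>y\<in>X-{x}. x - y))"
    unfolding q_def coeff_sum by (intro sum.cong) (auto simp: coeff_N)
  finally show ?thesis .
qed

lemma coeff_eq_lagrange_insert_0:
  fixes p :: "'a::field poly" and x :: "'i \<Rightarrow> 'a"
  assumes I: "finite I" "inj_on x I" "\<And>i. i \<in> I \<Longrightarrow> x i \<noteq> 0" and deg: "degree p \<le> card I"
  shows "coeff p (card I) = (-1) ^ card I * poly p 0 / (\<Prod>i\<in>I. x i)
    + (\<Sum>i\<in>I. poly p (x i) / (x i * (\<Prod>u\<in>I-{i}. x i - x u)))"
proof -
  have zero: "0 \<notin> x ` I"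
    using I(3) by force
  then have nodes: "finite (insert 0 (x ` I))" "card (insert 0 (x ` I)) = Suc (card I)"
    using I by (simp_all add: card_image)
  have "(\<Prod>y\<in>insert 0 (x ` I) - {0}. 0 - y) = (\<Prod>i\<in>I. (-1) * x i)"
    using I zero by (simp add: prod.reindex)
  then have at_0: "(\<Prod>y\<in>insert 0 (x ` I) - {0}. 0 - y) = (-1) ^ card I * (\<Prod>i\<in>I. x i)"
    unfolding prod.distrib by simp
  have at_node: "(\<Prod>y\<in>insert 0 (x ` I) - {x i}. x i - y) = x i * (\<Prod>u\<in>I-{i}. x i - x u)"
    if "i \<in> I" for i
  proof -
    have "insert 0 (x ` I) - {x i} = insert 0 (x ` (I - {i}))"
      using I that by (auto simp: inj_on_def)
    moreover have "inj_on x (I - {i})" "0 \<notin> x ` (I - {i})"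
      using I zero by (auto intro: inj_on_subset)
    ultimately show ?thesis
      using I(1) by (simp add: prod.reindex)
  qed
  have "coeff p (card I) = poly p 0 / (\<Prod>y\<in>insert 0 (x ` I) - {0}. 0 - y)
      + (\<Sum>z\<in>x ` I. poly p z / (\<Prod>y\<in>insert 0 (x ` I) - {z}. z - y))"
    using coeff_eq_lagrange[OF nodes deg] I(1) zero by simp
  also have "(\<Sum>z\<in>x ` I. poly p z / (\<Prod>y\<in>insert 0 (x ` I) - {z}. z - y))
      = (\<Sum>i\<in>I. poly p (x i) / (x i * (\<Prod>u\<in>I-{i}. x i - x u)))"
    by (subst sum.reindex[OF I(2)]) (simp add: at_node)
  also have "poly p 0 / (\<Prod>y\<in>insert 0 (x ` I) - {0}. 0 - y)
      = (-1) ^ card I * poly p 0 / (\<Prod>i\<in>I. x i)"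
    unfolding at_0 by (cases "even (card I)") auto
  finally show ?thesis .
qed

definition binomial_poly :: "nat \<Rightarrow> 'a::field_char_0 poly" where
  "binomial_poly s = smult (1 / fact s) (\<Prod>k<s. [:- of_nat k, 1:])"

lemma poly_binomial_poly: "poly (binomial_poly s) x = x gchoose s"
  by (simp add: binomial_poly_def poly_prod gbinomial_prod_rev atLeast0LessThan)

lemma degree_binomial_poly: "degree (binomial_poly s) = s"
proof -
  have "degree (\<Prod>k<s. [:- of_nat k :: 'a, 1:]) = (\<Sum>k<s. degree [:- of_nat k :: 'a, 1:])"
    by (rule degree_prod_eq_sum_degree) auto
  then show ?thesis by (simp add: binomial_poly_def)
qed

lemma lead_coeff_binomial_poly: "lead_coeff (binomial_poly s) = 1 / fact s"
  unfolding binomial_poly_def lead_coeff_smult by (simp add: lead_coeff_prod)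

abbreviation less_pairs :: "'i::linorder set \<Rightarrow> ('i \<times> 'i) set" where
  "less_pairs U \<equiv> {(u,v). u \<in> U \<and> v \<in> U \<and> u < v}"

lemma prod_less_pairs_remove:
  fixes f :: "'i::linorder \<Rightarrow> 'i \<Rightarrow> 'a::comm_monoid_mult"
  assumes U: "finite U" and i: "i \<in> U"
  shows "(\<Prod>(u,v)\<in>less_pairs U. f u v) = (\<Prod>(u,v)\<in>less_pairs (U - {i}). f u v)
    * ((\<Prod>u\<in>{u\<in>U. u < i}. f u i) * (\<Prod>v\<in>{v\<in>U. i < v}. f i v))"
proof -
  define below where "below = (\<lambda>u. (u, i)) ` {u\<in>U. u < i}"
  define above where "above = Pair i ` {v\<in>U. i < v}"
  have "less_pairs U = less_pairs (U - {i}) \<union> (below \<union> above)"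
    using i by (auto simp: below_def above_def)
  moreover have "finite (less_pairs (U - {i}))"
    by (rule finite_subset[of _ "U \<times> U"]) (use U in auto)
  moreover have "finite below" "finite above" "below \<inter> above = {}"
    "less_pairs (U - {i}) \<inter> (below \<union> above) = {}"
    using U by (auto simp: below_def above_def)
  ultimately have "prod (case_prod f) (less_pairs U)
      = prod (case_prod f) (less_pairs (U - {i}))
        * (prod (case_prod f) below * prod (case_prod f) above)"
    by (simp only: prod.union_disjoint finite_UnI)
  then show ?thesis
    by (simp add: below_def above_def prod.reindex inj_on_def)
qed

lemma vandermonde_remove:
  fixes x :: "'i::linorder \<Rightarrow> 'a::comm_ring_1"
  assumes U: "finite U" and i: "i \<in> U"
  shows "(\<Prod>(u,v)\<in>less_pairs (U - {i}). x v - x u) * (\<Prod>u\<in>U-{i}. x i - x u)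
    = (-1) ^ card {v\<in>U. i < v} * (\<Prod>(u,v)\<in>less_pairs U. x v - x u)"
proof -
  have split: "U - {i} = {u\<in>U. u < i} \<union> {v\<in>U. i < v}" by auto
  have "(\<Prod>u\<in>U-{i}. x i - x u) = (\<Prod>u\<in>{u\<in>U. u < i}. x i - x u) * (\<Prod>v\<in>{v\<in>U. i < v}. x i - x v)"
    unfolding split by (rule prod.union_disjoint) (use U in auto)
  also have "(\<Prod>v\<in>{v\<in>U. i < v}. x i - x v) = (\<Prod>v\<in>{v\<in>U. i < v}. (-1) * (x v - x i))"
    by simp
  also have "\<dots> = (-1) ^ card {v\<in>U. i < v} * (\<Prod>v\<in>{v\<in>U. i < v}. x v - x i)"
    unfolding prod.distrib by simp
  finally show ?thesis
    by (simp add: prod_less_pairs_remove[OF U i] mult_ac)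
qed

definition skip_vandermonde :: "(nat \<Rightarrow> nat) \<Rightarrow> nat \<Rightarrow> real" where
  "skip_vandermonde Q d = (\<Prod>u\<in>{1..d-1}. real (Q u) * (real (Q u) - 1))
    * (\<Prod>(u,v)\<in>less_pairs {1..d-1}. real (Q v) - real (Q u))"

lemma skip_vandermonde_pos:
  assumes Q: "Q 0 = 1" "strict_mono_on {..<d} Q"
  shows "skip_vandermonde Q d > 0"
proof -
  have "0 < (\<Prod>u\<in>{1..d-1}. real (Q u) * (real (Q u) - 1))"
  proof (rule prod_pos)
    fix u assume "u \<in> {1..d-1}"
    then have "Q 0 < Q u" by (intro strict_mono_onD[OF Q(2)]) auto
    then show "0 < real (Q u) * (real (Q u) - 1)" using Q(1) by simp
  qed
  moreover have "0 < (\<Prod>(u,v)\<in>less_pairs {1..d-1}. real (Q v) - real (Q u))"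
  proof (rule prod_pos, clarify)
    fix u v assume "u \<in> {1..d-1}" "v \<in> {1..d-1}" "u < v"
    then have "Q u < Q v" by (intro strict_mono_onD[OF Q(2)]) auto
    then show "0 < real (Q v) - real (Q u)" by simp
  qed
  ultimately show ?thesis
    by (simp add: skip_vandermonde_def)
qed

lemma ccoef_eq_skip_vandermonde:
  assumes Q: "Q 0 = 1" and i: "i \<in> {1..d-1}"
  shows "ccoef Q d i * (real (Q i) * (\<Prod>u\<in>{..<d}-{i}. real (Q i) - real (Q u)))
    = (-1) ^ (d - 1 - i) * skip_vandermonde Q d"
proof -
  let ?U = "{1..d-1}"
  have "{..<d} - {i} = insert 0 (?U - {i})" using i by auto
  then have "(\<Prod>u\<in>{..<d}-{i}. real (Q i) - real (Q u))
      = (real (Q i) - 1) * (\<Prod>u\<in>?U-{i}. real (Q i) - real (Q u))"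
    using Q by simp
  then have "ccoef Q d i * (real (Q i) * (\<Prod>u\<in>{..<d}-{i}. real (Q i) - real (Q u)))
      = (real (Q i) * (real (Q i) - 1) * (\<Prod>u\<in>?U-{i}. real (Q u) * (real (Q u) - 1)))
        * ((\<Prod>(u,v)\<in>less_pairs (?U-{i}). real (Q v) - real (Q u))
          * (\<Prod>u\<in>?U-{i}. real (Q i) - real (Q u)))"
    by (simp add: ccoef_def mult_ac)
  also have "real (Q i) * (real (Q i) - 1) * (\<Prod>u\<in>?U-{i}. real (Q u) * (real (Q u) - 1))
      = (\<Prod>u\<in>?U. real (Q u) * (real (Q u) - 1))"
    by (rule prod.remove[symmetric]) (use i in auto)
  also have "(\<Prod>(u,v)\<in>less_pairs (?U-{i}). real (Q v) - real (Q u))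
        * (\<Prod>u\<in>?U-{i}. real (Q i) - real (Q u))
      = (-1) ^ card {v\<in>?U. i < v} * (\<Prod>(u,v)\<in>less_pairs ?U. real (Q v) - real (Q u))"
    by (rule vandermonde_remove) (use i in auto)
  also have "{v\<in>?U. i < v} = {i<..d-1}" using i by auto
  finally show ?thesis by (simp add: skip_vandermonde_def mult_ac)
qed

lemma sum_ccoef_eq_coeff_diff:
  fixes p :: "real poly" and Q :: "nat \<Rightarrow> nat"
  assumes d: "1 \<le> d" and Q: "Q 0 = 1" "strict_mono_on {..<d} Q"
    and p: "degree p \<le> d" "poly p 0 = 1" "poly p 1 = 0"
  shows "(\<Sum>i=1..d-1. ccoef Q d i * ((-1) ^ i * poly p (Q i)))
    = skip_vandermonde Q d * (1 / (\<Prod>u<d. real (Q u)) - (-1) ^ d * coeff p d)"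
proof -
  define w where "w i = real (Q i) * (\<Prod>u\<in>{..<d}-{i}. real (Q i) - real (Q u))" for i
  have inj: "inj_on (\<lambda>u. real (Q u)) {..<d}"
    using strict_mono_on_imp_inj_on[OF Q(2)] by (simp add: inj_on_def)
  have pos: "real (Q u) \<noteq> 0" if "u < d" for u
    using Q(1) strict_mono_onD[OF Q(2), of 0 u] that by (cases "u = 0") auto
  have "coeff p d = (-1) ^ d / (\<Prod>u<d. real (Q u)) + (\<Sum>i<d. poly p (Q i) / w i)"
    using coeff_eq_lagrange_insert_0[OF _ inj, of p] pos p(1,2) by (simp add: w_def)
  also have "(\<Sum>i<d. poly p (Q i) / w i) = (\<Sum>i=1..d-1. poly p (Q i) / w i)"
    using d Q(1) p(3) by (intro sum.mono_neutral_right) (auto simp: not_le Suc_le_eq)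
  finally have lagrange:
      "(\<Sum>i=1..d-1. poly p (Q i) / w i) = coeff p d - (-1) ^ d / (\<Prod>u<d. real (Q u))"
    by simp
  have "ccoef Q d i * ((-1) ^ i * poly p (Q i))
      = - (skip_vandermonde Q d * (-1) ^ d) * (poly p (Q i) / w i)"
    if i: "i \<in> {1..d-1}" for i
  proof -
    have "w i \<noteq> 0"
      using i inj pos[of i] by (auto simp: w_def inj_on_def)
    then have "ccoef Q d i = (-1) ^ (d - 1 - i) * skip_vandermonde Q d / w i"
      using ccoef_eq_skip_vandermonde[of Q i d] Q(1) i by (simp add: w_def field_simps)
    moreover have "(-1 :: real) ^ d = - ((-1) ^ (d - 1 - i) * (-1) ^ i)"
      using d i by (cases d) (auto simp flip: power_add)
    ultimately show ?thesis by simp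
  qed
  then have "(\<Sum>i=1..d-1. ccoef Q d i * ((-1) ^ i * poly p (Q i)))
      = - (skip_vandermonde Q d * (-1) ^ d) * (\<Sum>i=1..d-1. poly p (Q i) / w i)"
    by (simp add: sum_distrib_left)
  also have "\<dots> = skip_vandermonde Q d * (1 / (\<Prod>u<d. real (Q u)) - (-1) ^ d * coeff p d)"
    unfolding lagrange by (simp add: algebra_simps)
  finally show ?thesis .
qed

lemma sum_ccoef_nonneg_iff:
  fixes p :: "real poly" and Q :: "nat \<Rightarrow> nat"
  assumes "1 \<le> d" "Q 0 = 1" "strict_mono_on {..<d} Q"
    and "degree p \<le> d" "poly p 0 = 1" "poly p 1 = 0"
  shows "(\<Sum>i=1..d-1. ccoef Q d i * ((-1) ^ i * poly p (Q i))) \<ge> 0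
    \<longleftrightarrow> (-1) ^ d * coeff p d \<le> 1 / (\<Prod>u<d. real (Q u))"
  unfolding sum_ccoef_eq_coeff_diff[OF assms]
  using skip_vandermonde_pos[OF assms(2,3)] by (simp add: zero_le_mult_iff)

section \<open>Counting\<close>

lemma card_supersets:
  assumes V: "finite V" "\<sigma> \<subseteq> V" and m: "card \<sigma> \<le> m"
  shows "card {W. W \<subseteq> V \<and> card W = m \<and> \<sigma> \<subseteq> W} = (card V - card \<sigma>) choose (m - card \<sigma>)"
proof -
  have fin: "finite \<sigma>" using V finite_subset by blast
  have "{W. W \<subseteq> V \<and> card W = m \<and> \<sigma> \<subseteq> W} = (\<union>) \<sigma> ` {T. T \<subseteq> V - \<sigma> \<and> card T = m - card \<sigma>}"
    (is "?supersets = (\<union>) \<sigma> ` ?T")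
  proof (intro equalityI subsetI)
    fix W assume "W \<in> ?supersets"
    then have "W - \<sigma> \<in> ?T" "W = \<sigma> \<union> (W - \<sigma>)"
      using fin by (auto simp: card_Diff_subset)
    then show "W \<in> (\<union>) \<sigma> ` ?T" by blast
  next
    fix W assume "W \<in> (\<union>) \<sigma> ` ?T"
    then obtain T where T: "T \<subseteq> V - \<sigma>" "card T = m - card \<sigma>" "W = \<sigma> \<union> T" by blast
    then have "finite T" using V(1) finite_subset by blast
    then have "card W = card \<sigma> + card T"
      unfolding T(3) using T(1) fin by (intro card_Un_disjoint) auto
    then show "W \<in> ?supersets" using T V(2) m by auto
  qed
  moreover have "inj_on ((\<union>) \<sigma>) ?T"
    by (rule inj_onI) blast
  ultimately have "card ?supersets = card ?T"
    by (simp add: card_image)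
  also have "\<dots> = card (V - \<sigma>) choose (m - card \<sigma>)"
    using V by (intro n_subsets) simp
  finally show ?thesis
    using V fin by (simp add: card_Diff_subset)
qed

lemma card_supersets_mult_choose:
  assumes V: "finite V" "\<sigma> \<subseteq> V" and m: "m \<le> card V"
  shows "card {W. W \<subseteq> V \<and> card W = m \<and> \<sigma> \<subseteq> W} * (card V choose card \<sigma>)
    = (card V choose m) * (m choose card \<sigma>)"
proof (cases "card \<sigma> \<le> m")
  case True
  then show ?thesis
    using choose_mult[OF True m] by (simp add: card_supersets[OF V] mult.commute)
next
  case False
  have "\<not> \<sigma> \<subseteq> W" if "W \<subseteq> V" "card W = m" for W
    using card_mono[of W \<sigma>] that V(1) False finite_subset[of W V] by auto
  then have "card {W. W \<subseteq> V \<and> card W = m \<and> \<sigma> \<subseteq> W} = 0"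
    by (intro card_eq_0_iff[THEN iffD2]) blast
  with False show ?thesis by simp
qed

lemma card_less_nth_sorted_list_of_set:
  fixes S :: "'a::linorder set"
  assumes S: "finite S" "i < card S"
  shows "card {x\<in>S. x < sorted_list_of_set S ! i} = i"
proof -
  let ?xs = "sorted_list_of_set S"
  have less: "?xs ! j < ?xs ! k \<longleftrightarrow> j < k" if "j < card S" "k < card S" for j k
    using sorted_wrt_nth_less[OF strict_sorted_list_of_set[of S]] that
    by (metis length_sorted_list_of_set linorder_neqE_nat order_less_asym order_less_irrefl)
  have "{x\<in>S. x < ?xs ! i} = {x\<in>(!) ?xs ` {..<card S}. x < ?xs ! i}"
    using S(1) set_sorted_list_of_set[of S] by (auto simp: set_conv_nth)
  also have "\<dots> = (!) ?xs ` {..<i}"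
    using S(2) by (auto simp: less image_iff)
  also have "card \<dots> = i"
    using S(2) inj_on_nth[of ?xs "{..<i}"] by (simp add: card_image)
  finally show ?thesis .
qed

lemma mono_on_less_if_le_card:
  fixes f :: "nat \<Rightarrow> 'a::linorder"
  assumes f: "mono_on {1..N} f" and k: "k \<in> {1..N}" "k \<le> card {l\<in>{1..N}. f l < x}"
  shows "f k < x"
proof (rule ccontr)
  assume not_less: "\<not> f k < x"
  have "l < k" if "l \<in> {1..N}" "f l < x" for l
    using mono_onD[OF f, of k l] that k(1) not_less by fastforce
  then have "{l\<in>{1..N}. f l < x} \<subseteq> {1..<k}" by auto
  from card_mono[OF _ this] have "card {l\<in>{1..N}. f l < x} \<le> k - 1" by simp
  with k show False by (simp only: atLeastAtMost_iff) linarith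
qed

section \<open>Maximal shifts and upper skips\<close>

locale labelled_complex =
  fixes K :: "'k::field itself" and n d :: nat and \<Gamma> :: "nat set set"
  assumes simplicial: "simplicial_complex n \<Gamma>" and d_eq: "d = Max (card ` \<Gamma>)"
begin

sublocale finite_complex "{1..n}" \<Gamma>
  using simplicial by unfold_locales (auto simp: simplicial_complex_def)

abbreviation M :: "nat \<Rightarrow> nat" where
  "M \<equiv> Mshift K n \<Gamma>"

abbreviation Q :: "nat \<Rightarrow> nat" where
  "Q \<equiv> upper_skip K n d \<Gamma>"

abbreviation \<beta> :: "nat set \<Rightarrow> int \<Rightarrow> nat" where
  "\<beta> W \<equiv> rbetti K (induced \<Gamma> W)"

definition shifts :: "nat \<Rightarrow> nat set" where
  "shifts i = {card W | W. W \<subseteq> {1..n} \<and> \<beta> W (int (card W) - int i - 1) \<noteq> 0}"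

definition skips :: "nat set" where
  "skips = {1..n} - M ` {1..n - d}"

lemma empty_face: "{} \<in> \<Gamma>"
  using simplicial by (simp add: simplicial_complex_def)

lemma vertex_face: "v \<in> {1..n} \<Longrightarrow> {v} \<in> \<Gamma>"
  using simplicial by (simp add: simplicial_complex_def)

lemma induced_empty: "induced \<Gamma> {} = {{}}"
  using empty_face by (auto simp: induced_def)

lemma card_face_le: "\<sigma> \<in> \<Gamma> \<Longrightarrow> card \<sigma> \<le> d"
  unfolding d_eq using finite_faces by simp

lemma d_le_n: "d \<le> n"
proof -
  have "d \<in> card ` \<Gamma>"
    unfolding d_eq using finite_faces empty_face by (intro Max_in) auto
  then show ?thesis
    using card_mono[OF _ face_subset_vertices] by fastforce
qed

lemma betti_eq_0_iff: "\<beta> W (int s - 1) = 0 \<longleftrightarrow> exact_at K {1..n} (induced \<Gamma> W) s"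
  using finite_complex.rbetti_eq_0_iff_exact_at[OF finite_complex_induced] .

lemma exact_at_0_induced:
  assumes "W \<subseteq> {1..n}" "W \<noteq> {}"
  shows "exact_at K {1..n} (induced \<Gamma> W) 0"
proof -
  obtain w where "w \<in> W" using assms by blast
  then show ?thesis
    using assms vertex_face
    by (intro finite_complex.exact_at_0[OF finite_complex_induced, of w]) (auto simp: induced_def)
qed

lemma mem_shifts_iff:
  "m \<in> shifts i \<longleftrightarrow>
     i \<le> m \<and> (\<exists>W\<subseteq>{1..n}. card W = m \<and> \<not> exact_at K {1..n} (induced \<Gamma> W) (m - i))"
proof (cases "i \<le> m")
  case True
  then have "\<beta> W (int (card W) - int i - 1) \<noteq> 0 \<longleftrightarrow> \<not> exact_at K {1..n} (induced \<Gamma> W) (m - i)"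
    if "card W = m" for W
    using betti_eq_0_iff[of W "m - i"] that by (simp add: of_nat_diff)
  with True show ?thesis
    unfolding shifts_def by blast
next
  case False
  then show ?thesis
    using rbetti_below_minus_1[of _ K] by (auto simp: shifts_def)
qed

lemma homology_extends:
  assumes W: "W \<subseteq> {1..n}" "\<not> exact_at K {1..n} (induced \<Gamma> W) s" and size: "card W + d < n + s"
  obtains T where "T \<subseteq> {1..n} - W" "T \<noteq> {}"
    "\<not> exact_at K {1..n} (induced \<Gamma> (W \<union> T)) (s + card T - 1)"
proof (rule ccontr)
  assume "\<not> thesis"
  with that have "\<exists>\<sigma>\<in>\<Gamma>. card \<sigma> = s + card ({1..n} - W)"
    using W(2) finite_complex_axioms by (intro face_of_unextendable_homology[where W = W]) blast+
  moreover have "card ({1..n} - W) = n - card W"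
    using W(1) finite_subset[OF W(1)] by (simp add: card_Diff_subset)
  ultimately show False
    using card_face_le size by fastforce
qed

lemma finite_shifts: "finite (shifts i)"
proof (rule finite_subset)
  show "shifts i \<subseteq> card ` Pow {1..n}" by (auto simp: shifts_def)
qed simp

lemma shifts_step:
  assumes i: "i < n - d" and m: "m \<in> shifts i"
  obtains m' where "m' \<in> shifts (Suc i)" "m < m'"
proof -
  from m obtain W where W: "i \<le> m" "W \<subseteq> {1..n}" "card W = m"
      "\<not> exact_at K {1..n} (induced \<Gamma> W) (m - i)"
    by (auto simp: mem_shifts_iff)
  have "card W + d < n + (m - i)"
    using i W(1,3) by simp
  then obtain T where T: "T \<subseteq> {1..n} - W" "T \<noteq> {}"
      "\<not> exact_at K {1..n} (induced \<Gamma> (W \<union> T)) (m - i + card T - 1)"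
    by (rule homology_extends[OF W(2,4)])
  have fin: "finite T" "finite W"
    using T(1) W(2) finite_subset by blast+
  then have "card T > 0" "card (W \<union> T) = m + card T"
    using T(1,2) W(3) by (auto simp: card_gt_0_iff intro!: card_Un_disjoint)
  moreover from this have "m + card T \<in> shifts (Suc i)"
    unfolding mem_shifts_iff using T W by (auto intro!: exI[of _ "W \<union> T"])
  ultimately show thesis using that by simp
qed

lemma shifts_nonempty: "i \<le> n - d \<Longrightarrow> shifts i \<noteq> {}"
proof (induction i)
  case 0
  then show ?case
  proof -
    have "0 \<in> shifts 0"
      using not_exact_at_empty_face[of K]
      by (auto simp: mem_shifts_iff induced_empty intro!: exI[of _ "{}"])
    then show ?thesis by blast
  qed
next
  case (Suc i)
  then show ?case
    by (metis Suc_leD Suc_le_lessD all_not_in_conv shifts_step)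
qed

lemma Mshift_eq: "M i = Max (shifts i)"
  by (simp add: Mshift_def shifts_def)

lemma Mshift_mem: "i \<le> n - d \<Longrightarrow> M i \<in> shifts i"
  unfolding Mshift_eq using finite_shifts shifts_nonempty by simp

lemma Mshift_ge: "m \<in> shifts i \<Longrightarrow> m \<le> M i"
  unfolding Mshift_eq by (rule Max_ge[OF finite_shifts])

lemma Mshift_less_Suc: "i < n - d \<Longrightarrow> M i < M (Suc i)"
  by (metis Mshift_ge Mshift_mem less_imp_le order_less_le_trans shifts_step)

lemma strict_mono_on_Mshift: "strict_mono_on {..n - d} M"
proof (rule strict_mono_onI)
  fix i j assume "i < j" "j \<in> {..n - d}"
  then show "M i < M j"
  proof (induction j)
    case (Suc j)
    then show ?case using Mshift_less_Suc[of j] by (cases "i = j") auto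
  qed simp
qed

lemma inj_on_Mshift: "inj_on M {1..n - d}"
  using strict_mono_on_imp_inj_on[OF strict_mono_on_Mshift] by (rule inj_on_subset) auto

lemma Mshift_ge_2:
  assumes i: "i \<in> {1..n - d}"
  shows "2 \<le> M i"
proof (rule ccontr)
  assume "\<not> 2 \<le> M i"
  moreover obtain W where W: "i \<le> M i" "W \<subseteq> {1..n}" "card W = M i"
      "\<not> exact_at K {1..n} (induced \<Gamma> W) (M i - i)"
    using Mshift_mem[of i] i by (auto simp: mem_shifts_iff)
  ultimately have "M i = 1" "i = 1" using i by auto
  with W(3) have "exact_at K {1..n} (induced \<Gamma> W) 0"
    by (intro exact_at_0_induced W(2)) auto
  with W(4) \<open>M i = 1\<close> \<open>i = 1\<close> show False by simp
qed

lemma Mshift_image_subset: "M ` {1..n - d} \<subseteq> {2..n}"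
proof (rule image_subsetI)
  fix i assume i: "i \<in> {1..n - d}"
  then obtain W where "W \<subseteq> {1..n}" "card W = M i"
    using Mshift_mem[of i] by (auto simp: mem_shifts_iff)
  then have "M i \<le> n" using card_mono[of "{1..n}" W] by simp
  with Mshift_ge_2[OF i] show "M i \<in> {2..n}" by simp
qed

lemma finite_skips: "finite skips"
  by (simp add: skips_def)

lemma card_skips: "card skips = d"
proof -
  have "M ` {1..n - d} \<subseteq> {1..n}" using Mshift_image_subset by auto
  then have "card skips = card {1..n} - card (M ` {1..n - d})"
    unfolding skips_def by (intro card_Diff_subset) simp_all
  then have "card skips = n - (n - d)"
    unfolding card_image[OF inj_on_Mshift] by simp
  then show ?thesis using d_le_n by simp
qed

lemma upper_skip_eq: "Q = (!) (sorted_list_of_set skips)"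
  by (simp add: fun_eq_iff upper_skip_def skips_def)

lemma strict_mono_on_upper_skip: "strict_mono_on {..<d} Q"
  unfolding upper_skip_eq
  using sorted_wrt_nth_less[OF strict_sorted_list_of_set[of skips]] card_skips
  by (intro strict_mono_onI) auto

lemma upper_skip_image: "Q ` {..<d} = skips"
proof -
  have "Q ` {..<d} = set (sorted_list_of_set skips)"
    by (auto simp: upper_skip_eq set_conv_nth card_skips)
  then show ?thesis using finite_skips by simp
qed

lemma upper_skip_mem: "u < d \<Longrightarrow> Q u \<in> skips"
  using upper_skip_image by auto

lemma upper_skip_range: "u < d \<Longrightarrow> Q u \<in> {1..n}"
  using upper_skip_mem by (auto simp: skips_def)

lemma upper_skip_0:
  assumes d: "1 \<le> d"
  shows "Q 0 = 1"
proof -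
  have "1 \<in> skips"
    using d d_le_n Mshift_image_subset by (force simp: skips_def)
  then obtain k where k: "k < d" "Q k = 1"
    unfolding upper_skip_image[symmetric] by auto
  then show ?thesis
    using strict_mono_onD[OF strict_mono_on_upper_skip, of 0 k] upper_skip_range[of 0]
    by (cases "k = 0") auto
qed

lemma card_Mshift_less_upper_skip:
  assumes i: "i < d"
  shows "card {k\<in>{1..n - d}. M k < Q i} + i + 1 = Q i"
proof -
  let ?B = "{k\<in>{1..n - d}. M k < Q i}"
  have "{1..<Q i} = {x\<in>skips. x < Q i} \<union> M ` ?B"
    using upper_skip_range[OF i] Mshift_image_subset by (fastforce simp: skips_def)
  moreover have "{x\<in>skips. x < Q i} \<inter> M ` ?B = {}"
    by (auto simp: skips_def)
  ultimately have "card {1..<Q i} = card {x\<in>skips. x < Q i} + card (M ` ?B)"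
    using finite_skips by (simp add: card_Un_disjoint)
  also have "card {x\<in>skips. x < Q i} = i"
    using card_less_nth_sorted_list_of_set[OF finite_skips] i
    by (simp add: upper_skip_eq card_skips)
  also have "card (M ` ?B) = card ?B"
    by (rule card_image) (auto intro: inj_on_subset[OF inj_on_Mshift])
  finally have "Q i - 1 = i + card ?B" by simp
  moreover have "1 \<le> Q i" using upper_skip_range[OF i] by simp
  ultimately show ?thesis by linarith
qed

text \<open>Otherwise \<open>Q\<^sub>i\<close> would be a shift in homological degree \<open>k = Q\<^sub>i - j - 1\<close>, so \<open>Q\<^sub>i \<le> M\<^sub>k\<close>; but
  \<open>Q\<^sub>i - i - 1 \<ge> k\<close> of the increasing maximal shifts lie below \<open>Q\<^sub>i\<close>.\<close>
lemma betti_vanishes_at_skip: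
  assumes i: "i < d" and j: "i \<le> j" and W: "W \<subseteq> {1..n}" "card W = Q i"
  shows "\<beta> W (int j) = 0"
proof -
  let ?B = "{k\<in>{1..n - d}. M k < Q i}"
  have "exact_at K {1..n} (induced \<Gamma> W) (Suc j)"
  proof (cases "Q i \<le> Suc j")
    case True
    have "W \<noteq> {}" using W(2) upper_skip_range[OF i] by auto
    with True W show ?thesis
      by (intro finite_complex.exact_at_ge_card[OF finite_complex_induced]) (auto simp: induced_def)
  next
    case False
    define k where "k = Q i - Suc j"
    have k: "1 \<le> k" "k \<le> card ?B" "Q i - k = Suc j"
      using False j card_Mshift_less_upper_skip[OF i] by (auto simp: k_def)
    moreover have "card ?B \<le> card {1..n - d}"
      by (rule card_mono) auto
    moreover have "mono_on {1..n - d} M"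
      using strict_mono_on_imp_mono_on[OF strict_mono_on_Mshift] by (rule mono_on_subset) auto
    ultimately have "M k < Q i"
      by (intro mono_on_less_if_le_card[where N = "n - d"]) auto
    then have "Q i \<notin> shifts k"
      using Mshift_ge by (meson leD)
    then show ?thesis
      using W k by (auto simp: mem_shifts_iff k_def)
  qed
  then show ?thesis
    using betti_eq_0_iff[of W "Suc j"] by simp
qed

lemma prod_Mshift_mult_prod_upper_skip:
  "(\<Prod>i=1..n-d. real (M i)) * (\<Prod>u<d. real (Q u)) = fact n"
proof -
  have "M ` {1..n - d} \<subseteq> {1..n}" using Mshift_image_subset by auto
  then have "\<Prod>(M ` {1..n - d}) * \<Prod>skips = \<Prod>{1..n}"
    unfolding skips_def by (metis finite_atLeastAtMost mult.commute prod.subset_diff)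
  moreover have "\<Prod>(M ` {1..n - d}) = (\<Prod>i=1..n-d. M i)"
    using prod.reindex[OF inj_on_Mshift, of "\<lambda>x. x"] by simp
  moreover have "\<Prod>skips = (\<Prod>u<d. Q u)"
    using prod.reindex[OF strict_mono_on_imp_inj_on[OF strict_mono_on_upper_skip], of "\<lambda>x. x"]
    by (simp add: upper_skip_image)
  ultimately have "real ((\<Prod>i=1..n-d. M i) * (\<Prod>u<d. Q u)) = real (fact n)"
    by (simp add: fact_prod)
  then show ?thesis by simp
qed

definition euler_poly :: "real poly" where
  "euler_poly = (\<Sum>\<sigma>\<in>\<Gamma>. smult ((-1) ^ card \<sigma> / real (n choose card \<sigma>)) (binomial_poly (card \<sigma>)))"

lemma poly_euler_poly:
  assumes m: "m \<le> n"
  shows "poly euler_poly (real m)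
    = (\<Sum>W\<in>{W. W \<subseteq> {1..n} \<and> card W = m}. euler_char (induced \<Gamma> W)) / real (n choose m)"
proof -
  let ?\<W> = "{W. W \<subseteq> {1..n} \<and> card W = m}"
  have fraction: "real (card {W\<in>?\<W>. \<sigma> \<subseteq> W}) / real (n choose m)
      = real (m choose card \<sigma>) / real (n choose card \<sigma>)" if "\<sigma> \<in> \<Gamma>" for \<sigma>
  proof -
    have "card {W\<in>?\<W>. \<sigma> \<subseteq> W} * (n choose card \<sigma>) = (n choose m) * (m choose card \<sigma>)"
      using card_supersets_mult_choose[of "{1..n}" \<sigma> m] face_subset_vertices[OF that] m
      by (simp add: conj_assoc)
    moreover have "n choose m > 0" "n choose card \<sigma> > 0"
      using m card_mono[OF _ face_subset_vertices[OF that]] by simp_all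
    ultimately show ?thesis
      by (simp add: frac_eq_eq mult.commute flip: of_nat_mult)
  qed
  have "(\<Sum>W\<in>?\<W>. euler_char (induced \<Gamma> W)) = (\<Sum>W\<in>?\<W>. \<Sum>\<sigma>\<in>{\<sigma>\<in>\<Gamma>. \<sigma> \<subseteq> W}. (-1) ^ card \<sigma>)"
    by (simp add: euler_char_def induced_def)
  also have "\<dots> = (\<Sum>\<sigma>\<in>\<Gamma>. \<Sum>W\<in>{W\<in>?\<W>. \<sigma> \<subseteq> W}. (-1) ^ card \<sigma>)"
    by (rule sum.swap_restrict) (simp_all add: finite_faces)
  finally have "(\<Sum>W\<in>?\<W>. euler_char (induced \<Gamma> W)) / real (n choose m)
      = (\<Sum>\<sigma>\<in>\<Gamma>. (-1) ^ card \<sigma> * (real (card {W\<in>?\<W>. \<sigma> \<subseteq> W}) / real (n choose m)))"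
    by (simp add: sum_divide_distrib mult.commute)
  also have "\<dots> = poly euler_poly (real m)"
    unfolding euler_poly_def poly_sum poly_smult poly_binomial_poly binomial_gbinomial[symmetric]
    by (intro sum.cong refl) (simp only: fraction, simp)
  finally show ?thesis ..
qed

lemma degree_euler_poly: "degree euler_poly \<le> d"
  unfolding euler_poly_def using card_face_le
  by (intro degree_sum_le finite_faces order_trans[OF degree_smult_le])
    (simp add: degree_binomial_poly)

lemma coeff_euler_poly:
  assumes d: "1 \<le> d"
  shows "coeff euler_poly d = (-1) ^ d * real (fvec \<Gamma> (d - 1)) / (real (n choose d) * fact d)"
proof -
  have "coeff euler_poly d
      = (\<Sum>\<sigma>\<in>\<Gamma>. if card \<sigma> = d then (-1) ^ d / real (n choose d) * (1 / fact d) else 0)"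
    unfolding euler_poly_def coeff_sum
  proof (rule sum.cong[OF refl])
    fix \<sigma> assume "\<sigma> \<in> \<Gamma>"
    then have "coeff (binomial_poly (card \<sigma>) :: real poly) d
        = (if card \<sigma> = d then 1 / fact d else 0)"
      using card_face_le[of \<sigma>] lead_coeff_binomial_poly[of d, where 'a = real]
      by (auto simp: degree_binomial_poly intro: coeff_eq_0)
    then show "coeff (smult ((-1) ^ card \<sigma> / real (n choose card \<sigma>)) (binomial_poly (card \<sigma>))) d
        = (if card \<sigma> = d then (-1) ^ d / real (n choose d) * (1 / fact d) else 0)"
      by simp
  qed
  also have "\<dots> = real (card {\<sigma>\<in>\<Gamma>. card \<sigma> = d}) * ((-1) ^ d / real (n choose d) * (1 / fact d))"
    using finite_faces by (simp flip: sum.inter_filter)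
  also have "card {\<sigma>\<in>\<Gamma>. card \<sigma> = d} = fvec \<Gamma> (d - 1)"
    using d by (simp add: fvec_def)
  finally show ?thesis by (simp add: mult_ac)
qed

lemma euler_poly_0: "poly euler_poly 0 = 1"
proof -
  have "W = {}" if "W \<subseteq> {1..n}" "card W = 0" for W
    using that finite_subset[OF that(1)] by simp
  then have "{W. W \<subseteq> {1..n} \<and> card W = 0} = {{}}" by auto
  then show ?thesis
    using poly_euler_poly[of 0] by (simp add: induced_empty euler_char_def)
qed

lemma euler_poly_1:
  assumes "1 \<le> d"
  shows "poly euler_poly 1 = 0"
proof -
  have "euler_char (induced \<Gamma> W) = 0" if W: "W \<subseteq> {1..n}" "card W = 1" for W
  proof -
    obtain w where "W = {w}" using W(2) by (rule card_1_singletonE)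
    then have "induced \<Gamma> W = {{}, {w}}"
      using W(1) empty_face vertex_face by (auto simp: induced_def)
    then show ?thesis by (simp add: euler_char_def)
  qed
  then show ?thesis
    using poly_euler_poly[of 1] assms d_le_n by simp
qed

lemma euler_char_at_skip:
  assumes i: "i \<in> {1..d-1}" and W: "W \<subseteq> {1..n}" "card W = Q i"
  shows "(-1) ^ i * euler_char (induced \<Gamma> W) = (\<Sum>j=0..i-1. (-1) ^ (i - j - 1) * real (\<beta> W (int j)))"
proof -
  have id: "i < d" using i by auto
  then have "W \<noteq> {}" using W(2) upper_skip_range[of i] by auto
  then have "\<beta> W (-1) = 0"
    using betti_eq_0_iff[of W 0] exact_at_0_induced[OF W(1)] by simp
  moreover have "euler_char (induced \<Gamma> W) = (\<Sum>s\<le>d. (-1) ^ s * real (\<beta> W (int s - 1)))"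
    using card_face_le
    by (intro finite_complex.euler_poincare[OF finite_complex_induced]) (auto simp: induced_def)
  ultimately have "euler_char (induced \<Gamma> W) = (\<Sum>j<d. (-1) ^ Suc j * real (\<beta> W (int j)))"
    by (simp add: sum.atMost_shift)
  also have "\<dots> = (\<Sum>j=0..i-1. (-1) ^ Suc j * real (\<beta> W (int j)))"
  proof (rule sum.mono_neutral_right)
    have "\<beta> W (int j) = 0" if "j \<in> {..<d} - {0..i-1}" for j
      using that by (intro betti_vanishes_at_skip[OF id _ W]) auto
    then show "\<forall>j\<in>{..<d} - {0..i-1}. (-1) ^ Suc j * real (\<beta> W (int j)) = 0" by simp
  qed (use i in auto)
  finally have "(-1) ^ i * euler_char (induced \<Gamma> W)
      = (\<Sum>j=0..i-1. (-1) ^ (i + Suc j) * real (\<beta> W (int j)))"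
    by (simp add: sum_distrib_left power_add mult.assoc)
  also have "\<dots> = (\<Sum>j=0..i-1. (-1) ^ (i - j - 1) * real (\<beta> W (int j)))"
  proof (rule sum.cong[OF refl])
    fix j assume "j \<in> {0..i-1}"
    then have "(-1 :: real) ^ (i + Suc j) = (-1) ^ (i - Suc j)"
      using i by (intro neg_one_power_add_eq_neg_one_power_diff) auto
    then show "(-1) ^ (i + Suc j) * real (\<beta> W (int j)) = (-1) ^ (i - j - 1) * real (\<beta> W (int j))"
      by simp
  qed
  finally show ?thesis .
qed

lemma euler_poly_at_skip:
  assumes i: "i \<in> {1..d-1}"
  shows "(-1) ^ i * poly euler_poly (real (Q i))
    = (\<Sum>j=0..i-1. (-1) ^ (i - j - 1) * Aavg K n \<Gamma> j (Q i))"
proof -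
  let ?\<W> = "{W. W \<subseteq> {1..n} \<and> card W = Q i}"
  have "i < d" using i by auto
  then have "Q i \<le> n" using upper_skip_range by auto
  then have "(-1) ^ i * poly euler_poly (real (Q i))
      = (\<Sum>W\<in>?\<W>. (-1) ^ i * euler_char (induced \<Gamma> W)) / real (n choose Q i)"
    by (simp add: poly_euler_poly sum_distrib_left)
  also have "\<dots> = (\<Sum>W\<in>?\<W>. \<Sum>j=0..i-1. (-1) ^ (i - j - 1) * real (\<beta> W (int j))) / real (n choose Q i)"
    using euler_char_at_skip[OF i] by simp
  also have "\<dots> = (\<Sum>j=0..i-1. (-1) ^ (i - j - 1) * Aavg K n \<Gamma> j (Q i))"
    unfolding Aavg_def by (subst sum.swap) (simp add: sum_distrib_left sum_divide_distrib)
  finally show ?thesis .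
qed

lemma fvec_le_prod_Mshift_iff:
  assumes d: "1 \<le> d"
  shows "real (fvec \<Gamma> (d - 1)) \<le> (\<Prod>i=1..n-d. real (M i)) / fact (n - d)
    \<longleftrightarrow> (-1) ^ d * coeff euler_poly d \<le> 1 / (\<Prod>u<d. real (Q u))"
proof -
  let ?c = "real (n choose d) * fact d" and ?q = "\<Prod>u<d. real (Q u)"
  have c: "?c > 0" using d_le_n by simp
  have q: "?q > 0"
    using upper_skip_range by (intro prod_pos) force
  have "(\<Prod>i=1..n-d. real (M i)) = fact n / ?q"
    using prod_Mshift_mult_prod_upper_skip q by (metis less_irrefl nonzero_eq_divide_eq)
  moreover have "fact n = ?c * fact (n - d)"
    by (simp add: binomial_fact[OF d_le_n])
  ultimately have "(\<Prod>i=1..n-d. real (M i)) / fact (n - d) = ?c / ?q"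
    by simp
  moreover have "(-1) ^ d * coeff euler_poly d = real (fvec \<Gamma> (d - 1)) / ?c"
    by (simp add: coeff_euler_poly[OF d] flip: mult.assoc power_add)
  ultimately show ?thesis
    using c q by (simp add: field_simps)
qed

lemma fvec_0_if_d_eq_0:
  assumes "d = 0"
  shows "fvec \<Gamma> 0 = 0"
proof -
  have "{\<sigma>\<in>\<Gamma>. card \<sigma> = 0 + 1} = {}" using card_face_le assms by fastforce
  then show ?thesis by (simp only: fvec_def card.empty)
qed

end

theorem theorem2p2:
  fixes K :: "'k::field itself" and n d :: nat and \<Gamma> :: "nat set set"
  assumes "simplicial_complex n \<Gamma>"
    and "d = Max (card ` \<Gamma>)"
  shows "real (fvec \<Gamma> (d - 1)) \<le> (\<Prod>i=1..n-d. real (Mshift K n \<Gamma> i)) / fact (n - d)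
     \<longleftrightarrow>
     (\<Sum>i=1..d-1. ccoef (upper_skip K n d \<Gamma>) d i *
        (\<Sum>j=0..i-1. (-1) ^ (i - j - 1) * Aavg K n \<Gamma> j (upper_skip K n d \<Gamma> i))) \<ge> 0"
proof -
  interpret labelled_complex K n d \<Gamma>
    by unfold_locales (fact assms)+
  show ?thesis
  proof (cases "d = 0")
    case True
    then show ?thesis by (simp add: fvec_0_if_d_eq_0 prod_nonneg)
  next
    case False
    then have d: "1 \<le> d" by simp
    have "real (fvec \<Gamma> (d - 1)) \<le> (\<Prod>i=1..n-d. real (M i)) / fact (n - d)
        \<longleftrightarrow> (-1) ^ d * coeff euler_poly d \<le> 1 / (\<Prod>u<d. real (Q u))"
      by (rule fvec_le_prod_Mshift_iff[OF d])
    also have "\<dots> \<longleftrightarrow> 0 \<le> (\<Sum>i=1..d-1. ccoef Q d i * ((-1) ^ i * poly euler_poly (Q i)))"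
      by (intro sum_ccoef_nonneg_iff[symmetric] d upper_skip_0 strict_mono_on_upper_skip
          degree_euler_poly euler_poly_0 euler_poly_1)
    also have "(\<Sum>i=1..d-1. ccoef Q d i * ((-1) ^ i * poly euler_poly (Q i)))
        = (\<Sum>i=1..d-1. ccoef Q d i * (\<Sum>j=0..i-1. (-1) ^ (i - j - 1) * Aavg K n \<Gamma> j (Q i)))"
      by (rule sum.cong) (simp_all only: euler_poly_at_skip)
    finally show ?thesis .
  qed
qed

end
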